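(* Assume $N\ge n\ge 1$. Let $f:\mathbb{B}^n\to\mathbb{B}^N$ be a rational holomorphic proper map with Hermitian invariant group $\Gamma_f$. Then $\Gamma_f$ contains a maximal compact subgroup of $\mathrm{Aut}(\mathbb{B}^n)$, that is, a conjugate (by an element of $\mathrm{Aut}(\mathbb{B}^n)$) of $\mathbf{U}(n)$, if and only if $f$ is spherically equivalent to a map of the form $$z\mapsto J_\lambda(z^{\otimes m_1},\dots,z^{\otimes m_k})\oplus 0=\lambda_1 z^{\otimes m_1}\oplus\cdots\oplus\lambda_k z^{\otimes m_k}\oplus 0,$$ where $k\ge 1$, $m_k>\cdots>m_2>m_1\ge 0$ are integers, and $\lambda=(\lambda_1,\dots,\lambda_k)\in\mathbb{C}^k$ satisfies $\|\lambda\|^2=1$.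
   Context: $\mathbb{B}^n$ is the open unit ball of $\mathbb{C}^n$, $\mathrm{Aut}(\mathbb{B}^n)$ is its group of holomorphic automorphisms, and $\mathbf{U}(n)\leqslant\mathrm{Aut}(\mathbb{B}^n)$ is the unitary group. The Hermitian invariant group of a rational proper map $f:\mathbb{B}^n\to\mathbb{B}^N$ is $$\Gamma_f=\{\gamma\in\mathrm{Aut}(\mathbb{B}^n):\ \text{there is } \psi\in\mathrm{Aut}(\mathbb{B}^N)\text{ with } f\circ\gamma=\psi\circ f\}.$$ Proper maps $f,g:\mathbb{B}^n\to\mathbb{B}^N$ are spherically equivalent if there are $\phi\in\mathrm{Aut}(\mathbb{B}^n)$ and $\chi\in\mathrm{Aut}(\mathbb{B}^N)$ with $f=\chi\circ g\circ\phi$. Here $z^{\otimes m}$ denotes the $m$-fold tensor power of the identity map, regarded (after a unitary map and discarding zero components) as the homogeneous map with components $\sqrt{m!/\alpha!}\;z^\alpha$, $|\alpha|=m$, in $\mathbb{C}^{\binom{n+m-1}{m}}$; it satisfies $\|z^{\otimes m}\|^2=\|z\|^{2m}$, and $z^{\otimes 0}=1$. The symbol $\oplus$ denotes orthogonal sum and $\oplus\,0$ means that zero components are adjoined (possibly none) so that the target is $\mathbb{C}^N$. *)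

theory Defs
  imports "HOL-Analysis.Analysis" "HOL-Algebra.Bij"
begin

text \<open>
  Complex \<open>n\<close>-space is \<open>complex ^ 'n\<close> with \<open>n = CARD('n)\<close>; its norm is the Euclidean norm, so the
  open unit ball is \<open>ball 0 1\<close>.  Maps on the ball are total HOL functions of which only the values
  on \<open>ball 0 1\<close> matter; only automorphisms, being elements of a group, are normalised to be
  extensional.
\<close>

definition holomorphic_map_on :: "(complex ^ 'n \<Rightarrow> complex ^ 'm) \<Rightarrow> (complex ^ 'n) set \<Rightarrow> bool" where
  "holomorphic_map_on f S \<longleftrightarrow>
     (\<forall>z\<in>S. \<exists>D. (f has_derivative D) (at z) \<and> Vector_Spaces.linear (*s) (*s) D)"

definition proper_holomorphic_ball_map :: "(complex ^ 'n \<Rightarrow> complex ^ 'm) \<Rightarrow> bool" where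
  "proper_holomorphic_ball_map f \<longleftrightarrow>
     f ` ball 0 1 \<subseteq> ball 0 1 \<and> holomorphic_map_on f (ball 0 1) \<and>
     proper_map (top_of_set (ball 0 1)) (top_of_set (ball 0 1)) f"

definition monomial :: "('n \<Rightarrow> nat) \<Rightarrow> complex ^ 'n \<Rightarrow> complex" where
  "monomial \<alpha> z = (\<Prod>i\<in>UNIV. (z $ i) ^ \<alpha> i)"

definition polynomial_fun :: "(complex ^ 'n \<Rightarrow> complex) \<Rightarrow> bool" where
  "polynomial_fun p \<longleftrightarrow> (\<exists>A c. finite A \<and> (\<forall>z. p z = (\<Sum>\<alpha>\<in>A. c \<alpha> * monomial \<alpha> z)))"

text \<open>
  The denominators are only required to be nonzero as polynomials, so they may vanish somewhere
  on the ball; for holomorphic \<open>f\<close> this is equivalent to having denominators without zeros there.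
\<close>

definition rational_on_ball :: "(complex ^ 'n \<Rightarrow> complex ^ 'm) \<Rightarrow> bool" where
  "rational_on_ball f \<longleftrightarrow>
     (\<forall>i. \<exists>p q. polynomial_fun p \<and> polynomial_fun q \<and> (\<exists>w. q w \<noteq> 0) \<and>
        (\<forall>z\<in>ball 0 1. q z \<noteq> 0 \<longrightarrow> f z $ i = p z / q z))"

definition ball_aut :: "(complex ^ 'n \<Rightarrow> complex ^ 'n) set" where
  "ball_aut = {\<gamma> \<in> Bij (ball 0 1).
     holomorphic_map_on \<gamma> (ball 0 1) \<and> holomorphic_map_on (inv_into (ball 0 1) \<gamma>) (ball 0 1)}"

lemma holomorphic_map_on_ball_cong: assumes "holomorphic_map_on f (ball 0 1)" "\<And>z. z \<in> ball 0 1 \<Longrightarrow> f z = g z"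
  shows "holomorphic_map_on g (ball 0 1)"
  unfolding holomorphic_map_on_def
proof
  fix z :: "complex^'a" assume z: "z \<in> ball 0 1"
  then obtain D where D: "(f has_derivative D) (at z)" "Vector_Spaces.linear (*s) (*s) D"
    using assms(1) unfolding holomorphic_map_on_def by blast
  have "(g has_derivative D) (at z)"
    by (rule has_derivative_transform_within_open[OF D(1) _ z]) (use assms(2) in auto)
  then show "\<exists>D. (g has_derivative D) (at z) \<and> Vector_Spaces.linear (*s) (*s) D" using D by blast
qed

lemma holomorphic_map_on_ball_compose: assumes "holomorphic_map_on f (ball 0 1)" "holomorphic_map_on g (ball 0 1)" "f ` ball 0 1 \<subseteq> ball 0 1"
  shows "holomorphic_map_on (\<lambda>z. g (f z)) (ball 0 1)"
  unfolding holomorphic_map_on_def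
proof
  fix z :: "complex^'a" assume z: "z \<in> ball 0 1"
  then obtain D where D: "(f has_derivative D) (at z)" "Vector_Spaces.linear (*s) (*s) D"
    using assms(1) unfolding holomorphic_map_on_def by blast
  have "f z \<in> ball 0 1" using z assms(3) by blast
  then obtain E where E: "(g has_derivative E) (at (f z))" "Vector_Spaces.linear (*s) (*s) E"
    using assms(2) unfolding holomorphic_map_on_def by blast
  have "((\<lambda>z. g (f z)) has_derivative (\<lambda>x. E (D x))) (at z)"
    by (rule has_derivative_compose[OF D(1) E(1)])
  moreover have "Vector_Spaces.linear (*s) (*s) (\<lambda>x. E (D x))"
    using Vector_Spaces.linear_compose[OF D(2) E(2)] by (simp add: o_def)
  ultimately show "\<exists>D. ((\<lambda>z. g (f z)) has_derivative D) (at z) \<and> Vector_Spaces.linear (*s) (*s) D" by blast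
qed

lemma ball_aut_subgroup: "subgroup (ball_aut :: (complex^'n \<Rightarrow> complex^'n) set) (BijGroup (ball 0 1))"
proof (rule group.subgroupI[OF group_BijGroup])
  let ?B = "ball (0::complex^'n) 1"
  show "ball_aut \<subseteq> carrier (BijGroup ?B)" by (auto simp: ball_aut_def BijGroup_def)
  have id: "holomorphic_map_on (\<lambda>x. x) ?B"
    unfolding holomorphic_map_on_def
    using vec.linear_id by (auto simp: id_def intro!: exI[of _ "\<lambda>x. x"] has_derivative_ident)
  have "restrict (\<lambda>x. x) ?B \<in> ball_aut"
    unfolding ball_aut_def
  proof (intro CollectI conjI id_Bij)
    show "holomorphic_map_on (\<lambda>x\<in>?B. x) ?B" by (rule holomorphic_map_on_ball_cong[OF id]) auto
    show "holomorphic_map_on (inv_into ?B (\<lambda>x\<in>?B. x)) ?B" 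
    proof (rule holomorphic_map_on_ball_cong[OF id])
      fix z assume "z \<in> ?B"
      then show "z = inv_into ?B (\<lambda>x\<in>?B. x) z"
        by (intro inv_into_f_eq[symmetric]) (auto simp: inj_on_def)
    qed
  qed
  then show "ball_aut \<noteq> ({} :: (complex^'n \<Rightarrow> complex^'n) set)" by blast
  fix a assume a: "a \<in> (ball_aut :: (complex^'n \<Rightarrow> complex^'n) set)"
  then have aB: "a \<in> Bij ?B" and ah: "holomorphic_map_on a ?B"
    and ai: "holomorphic_map_on (inv_into ?B a) ?B" by (simp_all add: ball_aut_def)
  from aB have bb: "bij_betw a ?B ?B" unfolding Bij_def by blast
  note bi = bij_betw_inv_into[OF bb]
  show "inv\<^bsub>BijGroup ?B\<^esub> a \<in> ball_aut"
    unfolding inv_BijGroup[OF aB] ball_aut_def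
  proof (intro CollectI conjI restrict_inv_into_Bij aB)
    show "holomorphic_map_on (restrict (inv_into ?B a) ?B) ?B"
      by (rule holomorphic_map_on_ball_cong[OF ai]) (simp only: restrict_apply')
    show "holomorphic_map_on (inv_into ?B (restrict (inv_into ?B a) ?B)) ?B"
    proof (rule holomorphic_map_on_ball_cong[OF ah])
      fix z assume z: "z \<in> ?B"
      have az: "a z \<in> ?B" by (rule bij_betwE[OF bb, rule_format, OF z])
      have "inj_on (restrict (inv_into ?B a) ?B) ?B"
        using bi unfolding bij_betw_def inj_on_restrict_eq by (rule conjunct1)
      moreover have "restrict (inv_into ?B a) ?B (a z) = z"
        using az bij_betw_inv_into_left[OF bb z] by (simp only: restrict_apply')
      ultimately show "a z = inv_into ?B (restrict (inv_into ?B a) ?B) z"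
        by (rule inv_into_f_eq[OF _ az, symmetric])
    qed
  qed
  fix b assume b: "b \<in> (ball_aut :: (complex^'n \<Rightarrow> complex^'n) set)"
  then have bB: "b \<in> Bij ?B" and bh: "holomorphic_map_on b ?B"
    and bhi: "holomorphic_map_on (inv_into ?B b) ?B" by (simp_all add: ball_aut_def)
  from bB have cb: "bij_betw b ?B ?B" unfolding Bij_def by blast
  have e: "a \<otimes>\<^bsub>BijGroup ?B\<^esub> b = compose ?B a b" using aB bB by (simp add: BijGroup_def)
  show "a \<otimes>\<^bsub>BijGroup ?B\<^esub> b \<in> ball_aut" unfolding e ball_aut_def
  proof (intro CollectI conjI compose_Bij aB bB)
    show "holomorphic_map_on (compose ?B a b) ?B"
      by (rule holomorphic_map_on_ball_cong[OF holomorphic_map_on_ball_compose[OF bh ah bij_betw_imp_surj_on[OF cb, THEN equalityD1]]])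
        (simp only: compose_eq)
    have cc: "bij_betw (compose ?B a b) ?B ?B"
      using compose_Bij[OF aB bB] unfolding Bij_def by blast
    show "holomorphic_map_on (inv_into ?B (compose ?B a b)) ?B"
    proof (rule holomorphic_map_on_ball_cong[OF holomorphic_map_on_ball_compose[OF ai bhi bij_betw_imp_surj_on[OF bi, THEN equalityD1]]])
      fix z assume z: "z \<in> ?B"
      have 1: "inv_into ?B a z \<in> ?B" by (rule bij_betwE[OF bi, rule_format, OF z])
      have 2: "inv_into ?B b (inv_into ?B a z) \<in> ?B"
        by (rule bij_betwE[OF bij_betw_inv_into[OF cb], rule_format, OF 1])
      have "compose ?B a b (inv_into ?B b (inv_into ?B a z)) = z"
        by (simp only: compose_eq[OF 2] bij_betw_inv_into_right[OF cb 1] bij_betw_inv_into_right[OF bb z])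
      then show "inv_into ?B b (inv_into ?B a z) = inv_into ?B (compose ?B a b) z"
        using bij_betw_inv_into_left[OF cc 2] by (simp only:)
    qed
  qed
qed

definition ball_aut_group :: "(complex ^ 'n \<Rightarrow> complex ^ 'n) monoid" where
  "ball_aut_group = BijGroup (ball 0 1)\<lparr>carrier := ball_aut\<rparr>"

lemma group_ball_aut_group: "group (ball_aut_group :: (complex^'n \<Rightarrow> complex^'n) monoid)"
  unfolding ball_aut_group_def
  by (rule group.subgroup_imp_group[OF group_BijGroup ball_aut_subgroup])

text \<open>The compact-open topology (locally uniform convergence on the ball).\<close>

definition ball_aut_topology :: "(complex ^ 'n \<Rightarrow> complex ^ 'n) topology" where
  "ball_aut_topology = topology_generated_by
     {{\<gamma> \<in> ball_aut. \<gamma> ` C \<subseteq> V} | C V. compact C \<and> C \<subseteq> ball 0 1 \<and> open V}"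

lemma topspace_ball_aut_topology: "topspace ball_aut_topology = (ball_aut :: (complex^'n \<Rightarrow> complex^'n) set)"
  unfolding ball_aut_topology_def topology_generated_by_topspace
  by (auto intro!: exI[of _ "ball_aut"] exI[of _ "{}"])

definition compact_subgroup :: "(complex ^ 'n \<Rightarrow> complex ^ 'n) set \<Rightarrow> bool" where
  "compact_subgroup K \<longleftrightarrow> subgroup K ball_aut_group \<and> compactin ball_aut_topology K"

definition maximal_compact_subgroup :: "(complex ^ 'n \<Rightarrow> complex ^ 'n) set \<Rightarrow> bool" where
  "maximal_compact_subgroup K \<longleftrightarrow>
     compact_subgroup K \<and> (\<forall>K'. compact_subgroup K' \<and> K \<subseteq> K' \<longrightarrow> K' = K)"

definition conjugate_transpose :: "complex ^ 'n ^ 'n \<Rightarrow> complex ^ 'n ^ 'n" where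
  "conjugate_transpose A = (\<chi> i j. cnj (A $ j $ i))"

definition unitary_matrix :: "complex ^ 'n ^ 'n \<Rightarrow> bool" where
  "unitary_matrix A \<longleftrightarrow> conjugate_transpose A ** A = mat 1 \<and> A ** conjugate_transpose A = mat 1"

definition unitary_auts :: "(complex ^ 'n \<Rightarrow> complex ^ 'n) set" where
  "unitary_auts = {restrict (\<lambda>z. A *v z) (ball 0 1) | A. unitary_matrix A}"

definition conjugate_of_unitary_auts :: "(complex ^ 'n \<Rightarrow> complex ^ 'n) \<Rightarrow> (complex ^ 'n \<Rightarrow> complex ^ 'n) set" where
  "conjugate_of_unitary_auts \<phi> =
     (\<lambda>u. \<phi> \<otimes>\<^bsub>ball_aut_group\<^esub> u \<otimes>\<^bsub>ball_aut_group\<^esub> inv\<^bsub>ball_aut_group\<^esub> \<phi>) ` unitary_auts"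

definition hermitian_invariant_group ::
  "(complex ^ 'n \<Rightarrow> complex ^ 'm) \<Rightarrow> (complex ^ 'n \<Rightarrow> complex ^ 'n) set" where
  "hermitian_invariant_group f =
     {\<gamma> \<in> ball_aut. \<exists>\<psi>\<in>ball_aut. \<forall>z\<in>ball 0 1. f (\<gamma> z) = \<psi> (f z)}"

definition spherically_equivalent ::
  "(complex ^ 'n \<Rightarrow> complex ^ 'm) \<Rightarrow> (complex ^ 'n \<Rightarrow> complex ^ 'm) \<Rightarrow> bool" where
  "spherically_equivalent f g \<longleftrightarrow>
     proper_holomorphic_ball_map f \<and> proper_holomorphic_ball_map g \<and>
     (\<exists>\<phi>\<in>ball_aut. \<exists>\<eta>\<in>ball_aut. \<forall>z\<in>ball 0 1. f z = \<eta> (g (\<phi> z)))"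

text \<open>The component of index \<open>\<alpha>\<close> of the tensor power of degree \<open>\<Sum>i. \<alpha> i\<close>.\<close>

definition tensor_power_component :: "('n \<Rightarrow> nat) \<Rightarrow> complex ^ 'n \<Rightarrow> complex" where
  "tensor_power_component \<alpha> z =
     complex_of_real (sqrt (fact (\<Sum>i\<in>UNIV. \<alpha> i) / (\<Prod>i\<in>UNIV. fact (\<alpha> i)))) * monomial \<alpha> z"

definition orthogonal_sum_index :: "nat \<Rightarrow> (nat \<Rightarrow> nat) \<Rightarrow> (nat \<times> ('n::finite \<Rightarrow> nat)) set" where
  "orthogonal_sum_index k m = {(j, \<alpha>). j \<in> {1..k} \<and> (\<Sum>i\<in>UNIV. \<alpha> i) = m j}"

text \<open>
  \<open>g\<close> is the map \<open>\<lambda>\<^sub>1 z^{\<otimes>m\<^sub>1} \<oplus> \<dots> \<oplus> \<lambda>\<^sub>k z^{\<otimes>m\<^sub>k} \<oplus> 0\<close>.  The coordinates of the target carry no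
  canonical order, so the injection \<open>e\<close> says which coordinate holds which component of the sum;
  its existence forces the sum to fit into the target.
\<close>

definition is_weighted_orthogonal_sum ::
  "nat \<Rightarrow> (nat \<Rightarrow> nat) \<Rightarrow> (nat \<Rightarrow> complex) \<Rightarrow> (complex ^ 'n \<Rightarrow> complex ^ 'm) \<Rightarrow> bool" where
  "is_weighted_orthogonal_sum k m lam g \<longleftrightarrow>
     (\<exists>e :: nat \<times> ('n \<Rightarrow> nat) \<Rightarrow> 'm. inj_on e (orthogonal_sum_index k m) \<and>
        (\<forall>z\<in>ball 0 1.
           (\<forall>(j, \<alpha>)\<in>orthogonal_sum_index k m. g z $ e (j, \<alpha>) = lam j * tensor_power_component \<alpha> z) \<and>
           (\<forall>l. l \<notin> e ` orthogonal_sum_index k m \<longrightarrow> g z $ l = 0)))"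

end

theory Submission
  imports Defs "HOL-Complex_Analysis.Conformal_Mappings"
begin

text \<open>
  Automorphisms of the ball are understood through the origin: by the Schwarz lemma an automorphism
  fixing the origin is unitary, and the explicit involutions \<open>ball_involution a\<close> move any point to
  the origin. Hence the conjugates of the unitary group are exactly the stabilizers of points, and
  the assertion on maximal compact subgroups says that a compact group of automorphisms fixes a
  point. The fixed point is the circumcentre of an orbit for the hyperbolic distance, whose
  uniqueness is a triangle inequality in the form of signature \<open>(1, n)\<close>
  (\<open>maximal_compact_subgroup_iff_conjugate\<close>).

  Let the invariant group of \<open>f\<close> contain a conjugate of the unitary group. After automorphisms of
  source and target have been applied, this becomes a map \<open>h\<close> with \<open>h 0 = 0\<close> whose invariant group
  contains all unitary matrices \<open>U\<close>. The automorphism \<open>\<psi>\<close> with \<open>h (U z) = \<psi> (h z)\<close> fixes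
  \<open>h 0 = 0\<close>, so it is unitary, and the kernel \<open>hip (h z) (h w)\<close> is invariant under the unitary group.
  Such a kernel is a polynomial in \<open>hip z w\<close> with positive coefficients
  (\<open>unitarily_invariant_kernel_polynomial\<close>): invariance and the maximum principle reduce it to a
  single complex line, rotations of that line make the Taylor coefficients of \<open>h\<close> on it pairwise
  orthogonal, and the target has room for finitely many orthogonal vectors only. Properness makes
  the sum of the coefficients \<open>1\<close>.

  The tensor power of degree \<open>m\<close> has the kernel \<open>hip z w ^ m\<close>, so a weighted orthogonal sum of
  tensor powers has the kernel of \<open>h\<close> as soon as the squared moduli of its weights are those
  coefficients. It fits into the target because linearly independent monomials in the kernel of \<open>h\<close>
  yield orthogonal vectors there (\<open>card_monomials_le_dimension\<close>). Two maps with the same kernel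
  differ by a unitary matrix (\<open>unitary_extension\<close>), hence \<open>h\<close> is spherically equivalent to the sum.
  The same principle, applied to \<open>g\<close> and \<open>g\<close> composed with a unitary matrix, gives the converse.
\<close>

section \<open>The Hermitian product and unitary matrices\<close>

text \<open>
  Linear in the first argument. The real inner product of the space is its real part, which does
  not see complex linearity.
\<close>

definition hip :: "complex ^ 'n \<Rightarrow> complex ^ 'n \<Rightarrow> complex" where
  "hip z w = (\<Sum>i\<in>UNIV. z $ i * cnj (w $ i))"

lemma hip_simps [simp]:
  "hip (x + y) z = hip x z + hip y z" "hip z (x + y) = hip z x + hip z y"
  "hip (x - y) z = hip x z - hip y z" "hip z (x - y) = hip z x - hip z y"
  "hip (- x) z = - hip x z" "hip z (- x) = - hip z x"
  "hip (c *s x) z = c * hip x z" "hip z (c *s x) = cnj c * hip z x"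
  "hip 0 z = 0" "hip z 0 = 0"
  by (simp_all add: hip_def algebra_simps sum.distrib sum_subtractf sum_negf sum_distrib_left)

lemma hip_sum_left: "hip (sum f A) w = (\<Sum>i\<in>A. hip (f i) w)"
  by (induction A rule: infinite_finite_induct) auto

lemma hip_sum_right: "hip w (sum f A) = (\<Sum>i\<in>A. hip w (f i))"
  by (induction A rule: infinite_finite_induct) auto

lemma cnj_hip: "cnj (hip z w) = hip w z"
  by (simp add: hip_def mult.commute)

lemma Re_hip: "Re (hip z w) = z \<bullet> w"
  by (simp add: hip_def inner_vec_def inner_complex_def)

lemma hip_self: "hip z z = complex_of_real ((norm z)\<^sup>2)"
proof -
  have "Im (hip z z) = 0"
    using cnj_hip[of z z] by (metis complex_cnj_cancel_iff complex_eq_iff cnj.sel(2) neg_equal_zero)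
  then show ?thesis
    by (simp add: complex_eq_iff Re_hip power2_norm_eq_inner)
qed

lemma hip_self_eq_0 [simp]: "hip z z = 0 \<longleftrightarrow> z = 0"
  by (simp add: hip_self)

lemma norm_eq_if_hip_eq: "hip z z = hip w w \<Longrightarrow> norm z = norm w"
  by (metis hip_self norm_ge_zero of_real_eq_iff power2_eq_iff_nonneg)

lemma norm_csmult: "norm (c *s z) = cmod c * norm (z :: complex ^ 'n)"
proof -
  have "(norm (c *s z))\<^sup>2 = (cmod c * norm z)\<^sup>2"
  proof -
    have "complex_of_real ((norm (c *s z))\<^sup>2) = of_real ((cmod c * norm z)\<^sup>2)"
        by (simp only: hip_self[symmetric] of_real_mult power_mult_distrib hip_simps complex_norm_square
          mult_ac)
    then show ?thesis using of_real_eq_iff by blast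
  qed
  then show ?thesis by (simp add: power2_eq_iff_nonneg)
qed

text \<open>
  A unimodular factor on one argument makes the product real and nonnegative; the claim is then
  the real inequality.
\<close>

lemma hip_Cauchy_Schwarz: "cmod (hip z w) \<le> norm z * norm w"
proof (cases "hip z w = 0")
  case False
  define c where "c = cnj (hip z w) / cmod (hip z w)"
  have c: "cmod c = 1" using False by (simp add: c_def norm_divide)
  have "hip (c *s z) w = of_real (cmod (hip z w))"
    using False by (simp add: c_def divide_simps)
      (metis complex_norm_square mult.commute power2_eq_square of_real_mult)
  then have "cmod (hip z w) = (c *s z) \<bullet> w" by (metis Re_hip Re_complex_of_real)
  also have "\<dots> \<le> norm (c *s z) * norm w" by (rule norm_cauchy_schwarz)
  finally show ?thesis by (simp add: norm_csmult c)
qed simp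

lemma cmod_hip_less_1: "norm z < 1 \<Longrightarrow> norm w < 1 \<Longrightarrow> cmod (hip z w) < 1"
  by (meson hip_Cauchy_Schwarz mult_strict_mono' norm_ge_zero order_le_less_trans less_eq_real_def
    mult_less_cancel_right2 mult_le_one order_less_le_trans mult_left_le)

lemma hip_neq_1: "norm z < 1 \<Longrightarrow> norm w < 1 \<Longrightarrow> 1 - hip z w \<noteq> 0"
  using cmod_hip_less_1[of z w] by auto

lemma hip_axis [simp]: "hip z (axis i 1) = z $ i" "hip (axis i 1) z = cnj (z $ i)"
proof -
  show "hip z (axis i 1) = z $ i"
    by (simp add: hip_def axis_def if_distrib cong: if_cong)
  then show "hip (axis i 1) z = cnj (z $ i)" by (metis cnj_hip)
qed

lemma hip_eqI: "(\<And>w. hip x w = hip y w) \<Longrightarrow> x = y"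
  by (metis hip_axis(1) vec_eq_iff)

lemma hip_conjugate_transpose: "hip (A *v x) y = hip x (conjugate_transpose A *v y)"
proof -
  have "hip (A *v x) y = (\<Sum>i\<in>UNIV. \<Sum>j\<in>UNIV. A $ i $ j * x $ j * cnj (y $ i))"
    by (simp add: hip_def matrix_vector_mult_def sum_distrib_right)
  also have "\<dots> = (\<Sum>j\<in>UNIV. \<Sum>i\<in>UNIV. A $ i $ j * x $ j * cnj (y $ i))"
    by (rule sum.swap)
  also have "\<dots> = hip x (conjugate_transpose A *v y)"
    by (simp add: hip_def matrix_vector_mult_def conjugate_transpose_def sum_distrib_left mult_ac)
  finally show ?thesis .
qed

lemma hip_unitary: "unitary_matrix A \<Longrightarrow> hip (A *v x) (A *v y) = hip x y"
  by (simp add: hip_conjugate_transpose matrix_vector_mul_assoc unitary_matrix_def)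

lemma norm_unitary: "unitary_matrix A \<Longrightarrow> norm (A *v x) = norm x"
  by (intro norm_eq_if_hip_eq) (simp add: hip_unitary)

lemma unitary_matrixI:
  assumes "\<And>x y. hip (A *v x) (A *v y) = hip x y"
  shows "unitary_matrix A"
proof -
  have "(conjugate_transpose A ** A) *v y = mat 1 *v y" for y
  proof (rule hip_eqI)
    fix x
    have "hip x ((conjugate_transpose A ** A) *v y) = hip x y"
      using assms[of x y] by (simp add: hip_conjugate_transpose matrix_vector_mul_assoc)
    then show "hip ((conjugate_transpose A ** A) *v y) x = hip (mat 1 *v y) x"
      by (metis cnj_hip matrix_vector_mul_lid)
  qed
  then have "conjugate_transpose A ** A = mat 1" by (simp add: matrix_eq)
  then show ?thesis
    unfolding unitary_matrix_def using matrix_left_right_inverse by blast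
qed

lemma hip_polarization:
  "hip x y = (of_real ((norm (x + y))\<^sup>2) - of_real ((norm (x - y))\<^sup>2)
     + \<i> * of_real ((norm (x + \<i> *s y))\<^sup>2) - \<i> * of_real ((norm (x - \<i> *s y))\<^sup>2)) / 4"
  unfolding hip_self[symmetric] by (simp add: algebra_simps)

text \<open>
  By polarization, a complex-linear map that preserves norms preserves the Hermitian product.
\<close>

lemma linear_isometry_unitary:
  fixes D :: "complex ^ 'n \<Rightarrow> complex ^ 'n"
  assumes lin: "Vector_Spaces.linear (*s) (*s) D" and iso: "\<And>x. norm (D x) = norm x"
  obtains A where "unitary_matrix A" "\<And>x. D x = A *v x"
proof
  show eq: "D x = matrix D *v x" for x
    using matrix_works[OF lin] by simp
  interpret D: Vector_Spaces.linear "(*s)" "(*s)" D by (rule lin)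
  show "unitary_matrix (matrix D)"
  proof (rule unitary_matrixI)
    fix x y
    show "hip (matrix D *v x) (matrix D *v y) = hip x y"
      unfolding eq[symmetric] unfolding hip_polarization[of "D x" "D y"] hip_polarization[of x y]
      by (simp only: D.add[symmetric] D.diff[symmetric] D.scale[symmetric] iso)
  qed
qed

lemma unitary_inverse:
  assumes "unitary_matrix A"
  shows "unitary_matrix (conjugate_transpose A)"
    "conjugate_transpose A *v (A *v x) = x" "A *v (conjugate_transpose A *v x) = x"
proof -
  show "conjugate_transpose A *v (A *v x) = x" "A *v (conjugate_transpose A *v x) = x"
    using assms by (simp_all add: unitary_matrix_def matrix_vector_mul_assoc)
  have "conjugate_transpose (conjugate_transpose A) = A"
    by (simp add: conjugate_transpose_def vec_eq_iff)
  then show "unitary_matrix (conjugate_transpose A)"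
    using assms by (simp add: unitary_matrix_def)
qed

lemma unitary_matrix_mult: "unitary_matrix A \<Longrightarrow> unitary_matrix B \<Longrightarrow> unitary_matrix (A ** B)"
  by (rule unitary_matrixI) (simp add: hip_unitary flip: matrix_vector_mul_assoc)

lemma unitary_matrix_scalar: "cmod c = 1 \<Longrightarrow> unitary_matrix (mat c)"
proof (rule unitary_matrixI)
  fix x y :: "complex ^ 'n"
  assume c: "cmod c = 1"
  have "mat c *v v = c *s v" for v :: "complex ^ 'n"
    by (simp add: mat_def matrix_vector_mult_def vec_eq_iff if_distrib if_distribR cong: if_cong)
  then show "hip (mat c *v x) (mat c *v y) = hip x y"
    using c complex_norm_square[of c] by (simp add: mult.commute flip: mult.assoc)
qed

section \<open>The Schwarz lemma and automorphisms fixing the origin\<close>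

lemma csmult_has_derivative: "((\<lambda>l. l *s z + w) has_derivative (\<lambda>h. h *s z)) (at (l::complex))"
proof -
  have "bounded_linear (\<lambda>l::complex. l *s z)"
    by (rule bounded_linear_intro[where K = "norm z"])
      (simp_all add: norm_csmult vec_eq_iff distrib_right)
  then show ?thesis by (auto intro!: derivative_eq_intros bounded_linear_imp_has_derivative)
qed

text \<open>
  Restriction to complex lines reduces every statement about holomorphic maps below to one complex
  variable.
\<close>

lemma slice_DERIV:
  fixes f :: "complex ^ 'n \<Rightarrow> complex ^ 'm"
  assumes "(f has_derivative D) (at (l *s z + w))" and "Vector_Spaces.linear (*s) (*s) D"
  shows "((\<lambda>l. f (l *s z + w) $ i) has_field_derivative (D z $ i)) (at l)"
proof -
  interpret D: Vector_Spaces.linear "(*s)" "(*s)" D by (rule assms)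
  have "((\<lambda>l. f (l *s z + w)) has_derivative (\<lambda>h. D (h *s z))) (at l)"
    by (rule has_derivative_compose[OF csmult_has_derivative[of z w l], of f D]) (rule assms(1))
  then have "((\<lambda>l. f (l *s z + w) $ i) has_derivative (\<lambda>h. D (h *s z) $ i)) (at l)"
    by (rule bounded_linear.has_derivative[OF bounded_linear_vec_nth])
  moreover have "(\<lambda>h. D (h *s z) $ i) = (*) (D z $ i)"
    by (auto simp: D.scale mult.commute)
  ultimately show ?thesis by (simp add: has_field_derivative_def)
qed

lemma slice_component_holomorphic:
  assumes "holomorphic_map_on f (ball 0 1)" and "\<And>l. l \<in> L \<Longrightarrow> norm (l *s z + w) < 1"
  shows "(\<lambda>l. f (l *s z + w) $ i) holomorphic_on L"
  unfolding holomorphic_on_def field_differentiable_def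
proof
  fix l assume "l \<in> L"
  then have "l *s z + w \<in> ball 0 1" using assms(2) by simp
  then obtain D where "(f has_derivative D) (at (l *s z + w))" "Vector_Spaces.linear (*s) (*s) D"
    using assms(1) unfolding holomorphic_map_on_def by blast
  from slice_DERIV[OF this]
  show "\<exists>f'. ((\<lambda>l. f (l *s z + w) $ i) has_field_derivative f') (at l within L)"
    by (blast intro: has_field_derivative_at_within)
qed

lemma slice_hip_holomorphic:
  assumes "holomorphic_map_on f (ball 0 1)" and "\<And>l. l \<in> L \<Longrightarrow> norm (l *s z + w) < 1"
  shows "(\<lambda>l. hip (f (l *s z + w)) v) holomorphic_on L"
  unfolding hip_def by (intro holomorphic_intros slice_component_holomorphic assms)

text \<open>
  The scalar function obtained by pairing a complex-line slice of \<open>f\<close> with a unit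
  vector is a self-map of the disc fixing \<open>0\<close>, so the one-variable Schwarz lemma
  applies, including its equality case.
\<close>

lemma Schwarz_slice:
  fixes f :: "complex ^ 'n \<Rightarrow> complex ^ 'm"
  assumes hol: "holomorphic_map_on f (ball 0 1)" and ball: "f ` ball 0 1 \<subseteq> ball 0 1"
    and f0: "f 0 = 0" and u: "norm u = 1" and v: "norm v = 1" and l: "cmod l < 1"
  shows "cmod (hip (f (l *s u)) v) \<le> cmod l"
    and "\<lbrakk>l \<noteq> 0; hip (f (l *s u)) v = l; cmod l' < 1\<rbrakk> \<Longrightarrow> hip (f (l' *s u)) v = l'"
proof -
  define F where "F = (\<lambda>l. hip (f (l *s u)) v)"
  have hF: "F holomorphic_on ball 0 1"
    unfolding F_def using slice_hip_holomorphic[OF hol, of "ball 0 1" u 0 v] u by (simp add: norm_csmult)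
  have F0: "F 0 = 0" by (simp add: F_def f0)
  have no: "cmod (F l) < 1" if "cmod l < 1" for l
  proof -
    have "f (l *s u) \<in> ball 0 1"
      using that u ball by (auto simp: image_subset_iff norm_csmult)
    then show ?thesis
      using hip_Cauchy_Schwarz[of "f (l *s u)" v] v by (simp add: F_def)
  qed
  note S = Schwarz_Lemma[OF hF F0 no]
  show "cmod (hip (f (l *s u)) v) \<le> cmod l" using S(1)[OF _ l] by (simp add: F_def)
  show "hip (f (l' *s u)) v = l'" if "l \<noteq> 0" "hip (f (l *s u)) v = l" "cmod l' < 1"
  proof -
    have "\<exists>z. norm z < 1 \<and> z \<noteq> 0 \<and> norm (F z) = norm z"
      using that l by (auto simp: F_def)
    then obtain a where a: "\<And>z. norm z < 1 \<Longrightarrow> F z = a * z" using S(3)[OF _ l] by blast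
    have "a = 1" using a[OF l] that by (simp add: F_def)
    then show ?thesis using a[OF that(3)] by (simp add: F_def)
  qed
qed

lemma norm_image_le_if_fixes_0:
  assumes hol: "holomorphic_map_on f (ball 0 1)" and ball: "f ` ball 0 1 \<subseteq> ball 0 1"
    and f0: "f 0 = 0" and z: "norm z < 1"
  shows "norm (f z) \<le> norm z"
proof (cases "z = 0 \<or> f z = 0")
  case False
  define u where "u = of_real (inverse (norm z)) *s z"
  define v where "v = of_real (inverse (norm (f z))) *s f z"
  have "norm u = 1" "norm v = 1" using False by (simp_all add: u_def v_def norm_csmult norm_inverse)
  then have "cmod (hip (f (of_real (norm z) *s u)) v) \<le> norm z"
    using Schwarz_slice(1)[OF hol ball f0, of u v "of_real (norm z)"] z by simp
  moreover have "of_real (norm z) *s u = z" 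
    using False by (simp add: u_def vector_smult_assoc flip: of_real_mult)
  moreover have "hip (f z) v = of_real (norm (f z))"
    using False by (simp add: v_def hip_self power2_eq_square)
  ultimately show ?thesis by simp
qed (use f0 in auto)

text \<open>
  Pair the slice in the direction of \<open>z\<close> with the direction \<open>v\<close> of
  \<open>f z\<close>. Equality holds in the Schwarz lemma, so the pairing is \<open>l \<mapsto>
  l\<close>. Since \<open>f\<close> also preserves norms, equality holds in the Cauchy-Schwarz
  inequality, and the slice itself is \<open>l \<mapsto> l *s v\<close>.
\<close>

lemma homogeneous_if_norm_preserving:
  assumes hol: "holomorphic_map_on f (ball 0 1)"
    and norm: "\<And>z. norm z < 1 \<Longrightarrow> norm (f z) = norm z"
    and z: "norm z < 1" and l: "cmod l \<le> 1"
  shows "f (l *s z) = l *s f z"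
proof (cases "z = 0")
  case True
  then show ?thesis using norm[of 0] by simp
next
  case False
  have f0: "f 0 = 0" using norm[of 0] by simp
  have ball: "f ` ball 0 1 \<subseteq> ball 0 1" using norm by auto
  define r where "r = norm z"
  define u where "u = of_real (inverse r) *s z"
  define v where "v = of_real (inverse r) *s f z"
  have r: "r > 0" "r < 1" using False z by (auto simp: r_def)
  have u: "norm u = 1" and v: "norm v = 1"
    using r norm[OF z] by (simp_all add: u_def v_def norm_csmult norm_inverse flip: r_def)
  have zu: "z = of_real r *s u" and fv: "f z = of_real r *s v"
    using r by (simp_all add: u_def v_def vector_smult_assoc flip: of_real_mult)
  have "hip (f (of_real r *s u)) v = of_real r"
    using v unfolding zu[symmetric] fv by (simp add: hip_self)
  then have hip: "hip (f (k *s u)) v = k" if "cmod k < 1" for k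
    using Schwarz_slice(2)[OF hol ball f0 u v, of "of_real r" k] r that by simp
  define k where "k = l * of_real r"
  have k: "cmod k < 1"
  proof -
    have "cmod l * r \<le> 1 * r" using l r by (intro mult_right_mono) auto
    moreover have "cmod k = cmod l * r" using r by (simp add: k_def norm_mult)
    ultimately show ?thesis using r by linarith
  qed
  have "hip (f (k *s u) - k *s v) (f (k *s u) - k *s v) = 0"
  proof -
    have "hip (f (k *s u)) (f (k *s u)) = of_real ((cmod k)\<^sup>2)"
      using norm[of "k *s u"] k u unfolding hip_self by (simp add: norm_csmult)
    moreover have "hip v (f (k *s u)) = cnj k" using hip[OF k] by (metis cnj_hip)
    moreover have "hip v v = 1" using v by (simp add: hip_self)
    ultimately show ?thesis
      using hip[OF k] unfolding hip_simps complex_norm_square by (simp add: mult.commute)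
  qed
  then have "f (k *s u) = k *s v" by (simp only: hip_self_eq_0 right_minus_eq)
  moreover have "k *s u = l *s z" by (subst zu) (simp add: k_def vector_smult_assoc)
  moreover have "k *s v = l *s f z" by (subst fv) (simp add: k_def vector_smult_assoc)
  ultimately show ?thesis by simp
qed

text \<open>
  Cartan's uniqueness theorem for the ball: the Schwarz lemma for the automorphism and for its
  inverse shows that norms are preserved. The automorphism is then homogeneous, so it equals its
  derivative at \<open>0\<close>, a linear isometry.
\<close>

proposition ball_aut_fixing_0_unitary:
  fixes g :: "complex ^ 'n \<Rightarrow> complex ^ 'n"
  assumes g: "g \<in> ball_aut" and g0: "g 0 = 0"
  obtains A where "unitary_matrix A" "\<And>z. z \<in> ball 0 1 \<Longrightarrow> g z = A *v z"
proof -
  let ?B = "ball (0 :: complex ^ 'n) 1"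
  let ?g = "inv_into ?B g"
  have bij: "bij_betw g ?B ?B" and hol: "holomorphic_map_on g ?B" and hol': "holomorphic_map_on ?g ?B"
    using g by (auto simp: ball_aut_def Bij_def)
  have ball: "g ` ?B \<subseteq> ?B" and ball': "?g ` ?B \<subseteq> ?B"
    using bij_betw_imp_surj_on[OF bij] bij_betw_imp_surj_on[OF bij_betw_inv_into[OF bij]] by auto
  have g'0: "?g 0 = 0" using bij_betw_inv_into_left[OF bij, of 0] g0 by simp
  have norm: "norm (g z) = norm z" if z: "norm z < 1" for z
  proof (rule antisym)
    show "norm (g z) \<le> norm z" by (rule norm_image_le_if_fixes_0[OF hol ball g0 z])
    have "norm (g z) < 1" using ball z by (meson image_subset_iff mem_ball_0)
    from norm_image_le_if_fixes_0[OF hol' ball' g'0 this]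
    show "norm z \<le> norm (g z)" using bij_betw_inv_into_left[OF bij, of z] z by simp
  qed
  note homog = homogeneous_if_norm_preserving[OF hol norm]
  obtain D where D: "(g has_derivative D) (at 0)" and lin: "Vector_Spaces.linear (*s) (*s) D"
    using hol unfolding holomorphic_map_on_def by force
  interpret D: Vector_Spaces.linear "(*s)" "(*s)" D by (rule lin)
  have eq: "g z = D z" if z: "norm z < 1" for z
  proof (rule vec_eq_iff[THEN iffD2], rule allI)
    fix i
    \<comment> \<open>Both are the derivative at \<open>0\<close> of the slice through \<open>z\<close>, which is linear by homogeneity.\<close>
    have "((\<lambda>l. g (l *s z + 0) $ i) has_field_derivative (D z $ i)) (at 0)"
      by (rule slice_DERIV[OF _ lin]) (use D in simp)
    moreover have "((\<lambda>l. g (l *s z + 0) $ i) has_field_derivative (g z $ i)) (at 0)"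
    proof (rule has_field_derivative_transform_within_open[where S = "ball 0 1"])
      show "((\<lambda>l. l * g z $ i) has_field_derivative (g z $ i)) (at 0)"
        by (auto intro!: derivative_eq_intros)
    qed (use homog z in auto)
    ultimately show "g z $ i = D z $ i" by (rule DERIV_unique[rotated])
  qed
  have "norm (D x) = norm x" for x
  proof -
    \<comment> \<open>A scaling that brings \<open>x\<close> into the ball, where \<open>D\<close> and \<open>g\<close> agree.\<close>
    define c where "c = complex_of_real (1 / (norm x + 1))"
    have 1: "cmod c = 1 / (norm x + 1)" unfolding c_def norm_of_real by simp
    have "norm x + 1 > 0" using norm_ge_zero[of x] by linarith
    then have c: "cmod c > 0" "cmod c * norm x < 1" by (simp_all only: 1) (simp_all add: field_simps)
    have "norm (c *s x) < 1" using c by (simp add: norm_csmult)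
    then have "norm (D (c *s x)) = norm (c *s x)" using norm eq by metis
    then show ?thesis using c by (simp add: D.scale norm_csmult)
  qed
  from linear_isometry_unitary[OF lin this] eq that show thesis by (metis mem_ball_0)
qed

section \<open>Coordinatewise holomorphy\<close>

text \<open>
  Additivity of \<open>D\<close> is part of being a derivative, so homogeneity over
  \<open>\<complex>\<close> is all that has to be demanded.
\<close>

definition complex_differentiable_at :: "(complex ^ 'n \<Rightarrow> complex) \<Rightarrow> complex ^ 'n \<Rightarrow> bool" where
  "complex_differentiable_at g z \<longleftrightarrow>
     (\<exists>D. (g has_derivative D) (at z) \<and> (\<forall>c x. D (c *s x) = c * D x))"

lemma complex_differentiable_const: "complex_differentiable_at (\<lambda>_. c) z"
  unfolding complex_differentiable_at_def by (rule exI[of _ "\<lambda>_. 0"]) auto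

lemma complex_differentiable_component: "complex_differentiable_at (\<lambda>z. z $ i) z"
  unfolding complex_differentiable_at_def
  by (rule exI[of _ "\<lambda>h. h $ i"])
    (auto intro: bounded_linear_imp_has_derivative bounded_linear_vec_nth)

lemma complex_differentiable_add:
  assumes "complex_differentiable_at f z" "complex_differentiable_at g z"
  shows "complex_differentiable_at (\<lambda>z. f z + g z) z"
proof -
  obtain D E where "(f has_derivative D) (at z)" "\<forall>c x. D (c *s x) = c * D x"
    "(g has_derivative E) (at z)" "\<forall>c x. E (c *s x) = c * E x"
    using assms unfolding complex_differentiable_at_def by auto
  then show ?thesis
    unfolding complex_differentiable_at_def
    by (intro exI[of _ "\<lambda>h. D h + E h"]) (auto intro!: derivative_intros simp: algebra_simps)
qed

lemma complex_differentiable_mult: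
  assumes "complex_differentiable_at f z" "complex_differentiable_at g z"
  shows "complex_differentiable_at (\<lambda>z. f z * g z) z"
proof -
  obtain D E where "(f has_derivative D) (at z)" "\<forall>c x. D (c *s x) = c * D x"
    "(g has_derivative E) (at z)" "\<forall>c x. E (c *s x) = c * E x"
    using assms unfolding complex_differentiable_at_def by auto
  then show ?thesis
    unfolding complex_differentiable_at_def
    by (intro exI[of _ "\<lambda>h. f z * E h + D h * g z"]) (auto intro!: derivative_eq_intros simp: algebra_simps)
qed

lemma complex_differentiable_inverse:
  assumes "complex_differentiable_at f z" "f z \<noteq> 0"
  shows "complex_differentiable_at (\<lambda>z. inverse (f z)) z"
proof -
  obtain D where D: "(f has_derivative D) (at z)" "\<forall>c x. D (c *s x) = c * D x"
    using assms unfolding complex_differentiable_at_def by auto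
  show ?thesis
    unfolding complex_differentiable_at_def
  proof (intro exI conjI)
    show "((\<lambda>z. inverse (f z)) has_derivative (\<lambda>h. - (inverse (f z) * D h * inverse (f z)))) (at z)"
      by (rule Deriv.has_derivative_inverse[OF assms(2) D(1)])
  qed (use D in auto)
qed

lemma complex_differentiable_sum:
  "(\<And>i. i \<in> A \<Longrightarrow> complex_differentiable_at (f i) z) \<Longrightarrow>
     complex_differentiable_at (\<lambda>z. \<Sum>i\<in>A. f i z) z"
  by (induction A rule: infinite_finite_induct)
    (auto intro: complex_differentiable_add complex_differentiable_const)

lemma complex_differentiable_diff:
  assumes "complex_differentiable_at f z" "complex_differentiable_at g z"
  shows "complex_differentiable_at (\<lambda>z. f z - g z) z"
  using complex_differentiable_add[OF assms(1)
      complex_differentiable_mult[OF complex_differentiable_const[of "-1"] assms(2)]] by simp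

lemma complex_differentiable_hip: "complex_differentiable_at (\<lambda>z. hip z a) z"
  unfolding hip_def
  by (intro complex_differentiable_sum complex_differentiable_mult complex_differentiable_const
      complex_differentiable_component)

lemma holomorphic_map_on_componentwiseI:
  fixes f :: "complex ^ 'n \<Rightarrow> complex ^ 'm"
  assumes "\<And>z i. z \<in> S \<Longrightarrow> complex_differentiable_at (\<lambda>z. f z $ i) z"
  shows "holomorphic_map_on f S"
  unfolding holomorphic_map_on_def
proof
  fix z assume "z \<in> S"
  then obtain D where D: "\<And>i. ((\<lambda>z. f z $ i) has_derivative D i) (at z)"
    "\<And>i c x. D i (c *s x) = c * D i x"
    using assms unfolding complex_differentiable_at_def by metis
  show "\<exists>E. (f has_derivative E) (at z) \<and> Vector_Spaces.linear (*s) (*s) E"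
  proof (intro exI conjI)
    show "(f has_derivative (\<lambda>h. \<chi> i. D i h)) (at z)"
    proof (subst has_derivative_componentwise_within, rule ballI)
      fix b :: "complex ^ 'm" assume "b \<in> Basis"
      then obtain i c where b: "b = axis i c" by (auto simp: Basis_vec_def)
      show "((\<lambda>x. f x \<bullet> b) has_derivative (\<lambda>h. (\<chi> i. D i h) \<bullet> b)) (at z)"
        unfolding b inner_axis using has_derivative_inner_left[OF D(1)[of i]] by simp
    qed
    have "D i (x + y) = D i x + D i y" for i x y
      using has_derivative_linear[OF D(1)] by (rule linear_add)
    then show "Vector_Spaces.linear (*s) (*s) (\<lambda>h. \<chi> i. D i h)"
      by (simp add: Vector_Spaces.linear_iff vec_eq_iff D(2) vec.vector_space_axioms)
  qed
qed

lemma holomorphic_map_on_matrix: "holomorphic_map_on (\<lambda>z. A *v z) S"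
  by (rule holomorphic_map_on_componentwiseI)
    (auto simp: matrix_vector_mult_def intro!: complex_differentiable_sum
      complex_differentiable_mult complex_differentiable_const complex_differentiable_component)

section \<open>The automorphism group of the ball\<close>

lemma ball_autI:
  fixes f g :: "complex ^ 'n \<Rightarrow> complex ^ 'n"
  assumes f: "\<And>z. z \<in> ball 0 1 \<Longrightarrow> f z \<in> ball 0 1" "holomorphic_map_on f (ball 0 1)"
    and g: "\<And>z. z \<in> ball 0 1 \<Longrightarrow> g z \<in> ball 0 1" "holomorphic_map_on g (ball 0 1)"
    and gf: "\<And>z. z \<in> ball 0 1 \<Longrightarrow> g (f z) = z" and fg: "\<And>z. z \<in> ball 0 1 \<Longrightarrow> f (g z) = z"
  shows "restrict f (ball 0 1) \<in> ball_aut"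
proof -
  let ?B = "ball (0 :: complex ^ 'n) 1"
  have bij: "bij_betw (restrict f ?B) ?B ?B"
    by (rule bij_betwI[where g = g]) (use assms in \<open>auto simp del: mem_ball_0\<close>)
  have "inv_into ?B (restrict f ?B) z = g z" if "z \<in> ?B" for z
    by (rule inv_into_f_eq) (use bij that g fg in \<open>auto simp: bij_betw_def simp del: mem_ball_0\<close>)
  then have "holomorphic_map_on (inv_into ?B (restrict f ?B)) ?B"
    by (metis holomorphic_map_on_ball_cong[OF g(2)])
  moreover have "holomorphic_map_on (restrict f ?B) ?B"
    by (rule holomorphic_map_on_ball_cong[OF f(2)]) simp
  ultimately show ?thesis using bij by (simp add: ball_aut_def Bij_def)
qed

lemma ball_autD:
  assumes "g \<in> ball_aut"
  shows "bij_betw g (ball 0 1) (ball 0 1)" "holomorphic_map_on g (ball 0 1)"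
    "z \<in> ball 0 1 \<Longrightarrow> g z \<in> ball 0 1" "g \<in> extensional (ball 0 1)"
  using assms by (auto simp: ball_aut_def Bij_def dest: bij_betwE)

lemma ball_aut_eqI:
  assumes "g \<in> ball_aut" "h \<in> ball_aut" "\<And>z. z \<in> ball 0 1 \<Longrightarrow> g z = h z"
  shows "g = h"
  using assms(3) by (rule extensionalityI[OF ball_autD(4)[OF assms(1)] ball_autD(4)[OF assms(2)]])

lemma carrier_ball_aut_group [simp]: "carrier ball_aut_group = ball_aut"
  by (simp add: ball_aut_group_def)

lemma ball_aut_mult:
  assumes "g \<in> ball_aut" "h \<in> ball_aut"
  shows "g \<otimes>\<^bsub>ball_aut_group\<^esub> h \<in> ball_aut"
    "z \<in> ball 0 1 \<Longrightarrow> (g \<otimes>\<^bsub>ball_aut_group\<^esub> h) z = g (h z)"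
proof -
  show "g \<otimes>\<^bsub>ball_aut_group\<^esub> h \<in> ball_aut"
    using monoid.m_closed[OF group.is_monoid[OF group_ball_aut_group]] assms by simp
  show "z \<in> ball 0 1 \<Longrightarrow> (g \<otimes>\<^bsub>ball_aut_group\<^esub> h) z = g (h z)"
    using assms by (simp add: ball_aut_group_def BijGroup_def ball_aut_def compose_def del: mem_ball_0)
qed

lemma ball_aut_one: "\<one>\<^bsub>ball_aut_group\<^esub> \<in> ball_aut" "z \<in> ball 0 1 \<Longrightarrow> \<one>\<^bsub>ball_aut_group\<^esub> z = z"
  using monoid.one_closed[OF group.is_monoid[OF group_ball_aut_group]]
  by (simp_all add: ball_aut_group_def BijGroup_def)

lemma ball_aut_inverse:
  assumes "g \<in> ball_aut"
  shows "inv\<^bsub>ball_aut_group\<^esub> g \<in> ball_aut"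
    "z \<in> ball 0 1 \<Longrightarrow> (inv\<^bsub>ball_aut_group\<^esub> g) z \<in> ball 0 1"
    "z \<in> ball 0 1 \<Longrightarrow> (inv\<^bsub>ball_aut_group\<^esub> g) (g z) = z"
    "z \<in> ball 0 1 \<Longrightarrow> g ((inv\<^bsub>ball_aut_group\<^esub> g) z) = z"
proof -
  note G = group_ball_aut_group
  show inv: "inv\<^bsub>ball_aut_group\<^esub> g \<in> ball_aut"
    using group.inv_closed[OF G] assms by simp
  show "z \<in> ball 0 1 \<Longrightarrow> (inv\<^bsub>ball_aut_group\<^esub> g) z \<in> ball 0 1" by (rule ball_autD(3)[OF inv])
  show "z \<in> ball 0 1 \<Longrightarrow> (inv\<^bsub>ball_aut_group\<^esub> g) (g z) = z"
    using group.l_inv[OF G, of g] assms ball_aut_mult(2)[OF inv assms, of z] ball_aut_one(2)[of z] by simp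
  show "z \<in> ball 0 1 \<Longrightarrow> g ((inv\<^bsub>ball_aut_group\<^esub> g) z) = z"
    using group.r_inv[OF G, of g] assms ball_aut_mult(2)[OF assms inv, of z] ball_aut_one(2)[of z] by simp
qed

lemma unitary_ball_aut:
  assumes "unitary_matrix A" shows "restrict (\<lambda>z. A *v z) (ball 0 1) \<in> ball_aut"
  by (rule ball_autI[where g = "\<lambda>z. conjugate_transpose A *v z"])
    (use assms in \<open>auto simp: holomorphic_map_on_matrix norm_unitary unitary_inverse\<close>)

section \<open>Involutions interchanging a point with the origin\<close>

text \<open>
  The usual formula has the term \<open>((1 - s) / (norm a)\<^sup>2) * hip z a\<close> in place of
  \<open>hip z a / (1 + s)\<close>. The two agree because \<open>(norm a)\<^sup>2 = (1 - s) * (1 +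
  s)\<close>, and the form used here has no singularity at \<open>a = 0\<close>.
\<close>

definition ball_involution :: "complex ^ 'n \<Rightarrow> complex ^ 'n \<Rightarrow> complex ^ 'n" where
  "ball_involution a z = (let s = complex_of_real (sqrt (1 - (norm a)\<^sup>2)) in
     inverse (1 - hip z a) *s ((1 - hip z a / (1 + s)) *s a - s *s z))"

lemma ball_involution_radius:
  assumes "norm a < 1"
  defines "s \<equiv> complex_of_real (sqrt (1 - (norm a)\<^sup>2))"
  shows "s\<^sup>2 = 1 - hip a a" "1 + s \<noteq> 0" "cnj s = s" "s \<noteq> 0"
proof -
  have 1: "(norm a)\<^sup>2 < 1" using assms(1) by (simp add: power_less_one_iff abs_square_less_1)
  then show "s\<^sup>2 = 1 - hip a a" by (simp add: s_def hip_self flip: of_real_power)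
  have 2: "sqrt (1 - (norm a)\<^sup>2) > 0" using 1 by simp
  then have "1 + sqrt (1 - (norm a)\<^sup>2) \<noteq> 0" by linarith
  then show "1 + s \<noteq> 0" unfolding s_def using of_real_eq_0_iff[of "1 + sqrt (1 - (norm a)\<^sup>2)", where ?'a = complex] by simp
  show "cnj s = s" by (simp add: s_def)
  show "s \<noteq> 0" using 2 by (simp add: s_def)
qed

text \<open>
  In homogeneous coordinates the involution is a matrix preserving, up to a scalar, the form of
  signature \<open>(1, n)\<close>; the denominators are the factors that return to affine
  coordinates. The proof expands both sides as polynomials in \<open>s\<close>, \<open>X\<close>
  and \<open>Y\<close>.
\<close>

lemma hip_ball_involution:
  assumes a: "norm a < 1" and z: "norm z < 1" and w: "norm w < 1"
  shows "1 - hip (ball_involution a z) (ball_involution a w) =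
    (1 - hip a a) * (1 - hip z w) / ((1 - hip z a) * (1 - hip a w))"
proof -
  define s where "s = complex_of_real (sqrt (1 - (norm a)\<^sup>2))"
  note s = ball_involution_radius[OF a, folded s_def]
  define X where "X = hip z a / (1 + s)"
  define Y where "Y = hip a w / (1 + s)"
  have X: "hip z a = X * (1 + s)" and Y: "hip a w = Y * (1 + s)" using s by (simp_all add: X_def Y_def)
  have aa: "hip a a = 1 - s\<^sup>2" using s by simp
  have Y': "hip w a = cnj Y * (1 + s)"
    using arg_cong[OF Y, of cnj] by (simp add: cnj_hip s(3))
  have nz: "1 - X * (1 + s) \<noteq> 0" "1 - Y * (1 + s) \<noteq> 0"
    using hip_neq_1[OF z a] hip_neq_1[OF a w] by (simp_all add: X Y)
  have mz: "ball_involution a z = inverse (1 - X * (1 + s)) *s ((1 - X) *s a - s *s z)"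
    using s(2) by (simp add: ball_involution_def Let_def X flip: s_def)
  have mw: "ball_involution a w = inverse (1 - cnj Y * (1 + s)) *s ((1 - cnj Y) *s a - s *s w)"
    using s(2) by (simp add: ball_involution_def Let_def Y' flip: s_def)
  have "hip (ball_involution a z) (ball_involution a w) =
     inverse (1 - X * (1 + s)) * inverse (1 - Y * (1 + s)) *
     ((1 - X) * (1 - Y) * (1 - s\<^sup>2) - (1 - X) * s * (Y * (1 + s))
       - s * (X * (1 + s)) * (1 - Y) + s\<^sup>2 * hip z w)"
    unfolding mz mw hip_simps X Y aa
    by (simp add: s(3)) (simp add: algebra_simps power2_eq_square)
  moreover have "(1 - X * (1 + s)) * (1 - Y * (1 + s)) - ((1 - X) * (1 - Y) * (1 - s\<^sup>2) - (1 - X) * s * (Y * (1 + s))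
       - s * (X * (1 + s)) * (1 - Y) + s\<^sup>2 * hip z w) = s\<^sup>2 * (1 - hip z w)"
    by (simp add: algebra_simps power2_eq_square)
  moreover have "1 - inverse p * inverse q * t = (p * q - t) / (p * q)"
    if "p \<noteq> 0" "q \<noteq> 0" for p q t :: complex
    using that by (simp add: field_simps)
  ultimately show ?thesis
    using nz unfolding X Y aa by simp
qed

lemma one_minus_hip_self_pos: "norm z < 1 \<Longrightarrow> 1 - (norm z)\<^sup>2 > 0"
  by (simp add: power_less_one_iff abs_square_less_1)

lemma norm_ball_involution:
  assumes a: "norm a < 1" and z: "norm z < 1"
  shows "1 - (norm (ball_involution a z))\<^sup>2 = (1 - (norm a)\<^sup>2) * (1 - (norm z)\<^sup>2) / (cmod (1 - hip z a))\<^sup>2"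
proof -
  have "complex_of_real (1 - (norm (ball_involution a z))\<^sup>2) =
      of_real ((1 - (norm a)\<^sup>2) * (1 - (norm z)\<^sup>2) / (cmod (1 - hip z a))\<^sup>2)"
    using hip_ball_involution[OF a z z] complex_norm_square[of "1 - hip z a"]
    by (simp add: hip_self cnj_hip)
  then show ?thesis by (simp only: of_real_eq_iff)
qed

lemma ball_involution_in_ball:
  assumes a: "norm a < 1" and z: "norm z < 1"
  shows "norm (ball_involution a z) < 1"
proof -
  have "1 - (norm (ball_involution a z))\<^sup>2 > 0"
    unfolding norm_ball_involution[OF assms] using hip_neq_1[OF z a]
    by (intro divide_pos_pos mult_pos_pos one_minus_hip_self_pos assms) auto
  then show ?thesis by (simp add: abs_square_less_1)
qed

lemma ball_involution_involution:
  assumes a: "norm a < 1" and z: "norm z < 1"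
  shows "ball_involution a (ball_involution a z) = z"
proof -
  define s where "s = complex_of_real (sqrt (1 - (norm a)\<^sup>2))"
  note s = ball_involution_radius[OF a, folded s_def]
  define X where "X = hip z a / (1 + s)"
  define d where "d = 1 - X * (1 + s)"
  have X: "hip z a = X * (1 + s)" using s by (simp add: X_def)
  have d: "d \<noteq> 0" using hip_neq_1[OF z a] by (simp add: d_def X)
  have aa: "hip a a = 1 - s\<^sup>2" using s by simp
  have mz: "ball_involution a z = inverse d *s ((1 - X) *s a - s *s z)"
    using s(2) by (simp add: ball_involution_def Let_def X d_def flip: s_def)
  have "(1 - X) * (1 - s\<^sup>2) - s * (X * (1 + s)) = d - s\<^sup>2"
    by (simp add: d_def algebra_simps power2_eq_square)
  then have h: "hip (ball_involution a z) a = 1 - s\<^sup>2 / d"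
    using d unfolding mz hip_simps aa X by (simp add: field_simps)
  have "1 - (1 - s\<^sup>2 / d) / (1 + s) = s * (1 - X) / d"
    using d s(2) by (simp add: divide_simps) (simp add: d_def algebra_simps power2_eq_square)
  then have "ball_involution a (ball_involution a z) = (d / s\<^sup>2) *s ((s * (1 - X) / d) *s a - s *s ball_involution a z)"
    unfolding ball_involution_def[of a "ball_involution a z"] Let_def s_def[symmetric] h by simp
  then show ?thesis
    using d s(4) unfolding mz by (simp add: vec_eq_iff field_simps power2_eq_square)
qed

lemma ball_involution_0 [simp]: "ball_involution a 0 = a"
  by (simp add: ball_involution_def Let_def)

lemma ball_involution_ball_aut:
  assumes a: "norm a < 1" shows "restrict (ball_involution a) (ball 0 1) \<in> ball_aut"
proof -
  have "holomorphic_map_on (ball_involution a) (ball 0 1)"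
    unfolding ball_involution_def Let_def divide_inverse
    using hip_neq_1[OF _ a]
    by (intro holomorphic_map_on_componentwiseI)
      (auto intro!: complex_differentiable_mult complex_differentiable_diff
        complex_differentiable_const complex_differentiable_component
        complex_differentiable_inverse complex_differentiable_hip)
  then show ?thesis
    by (intro ball_autI[where g = "ball_involution a"]) (auto simp: a ball_involution_in_ball ball_involution_involution)
qed

text \<open>
  Composing with the involution at the preimage of the origin gives an automorphism fixing the
  origin.
\<close>

proposition ball_aut_decomposition:
  assumes g: "g \<in> ball_aut"
  obtains A a where "unitary_matrix A" "norm a < 1" "\<And>z. norm z < 1 \<Longrightarrow> g z = A *v ball_involution a z"
proof -
  define a where "a = (inv\<^bsub>ball_aut_group\<^esub> g) 0"
  have a: "norm a < 1" and ga: "g a = 0"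
    using ball_aut_inverse(2,4)[OF g, of 0] by (simp_all add: a_def)
  let ?m = "restrict (ball_involution a) (ball 0 1)"
  have "(g \<otimes>\<^bsub>ball_aut_group\<^esub> ?m) 0 = 0"
    using ball_aut_mult(2)[OF g ball_involution_ball_aut[OF a], of 0] ga by simp
  from ball_aut_fixing_0_unitary[OF ball_aut_mult(1)[OF g ball_involution_ball_aut[OF a]] this]
  obtain A where A: "unitary_matrix A"
    "\<And>z. z \<in> ball 0 1 \<Longrightarrow> (g \<otimes>\<^bsub>ball_aut_group\<^esub> ?m) z = A *v z" by blast
  have "g z = A *v ball_involution a z" if z: "norm z < 1" for z
    using A(2)[of "ball_involution a z"] ball_aut_mult(2)[OF g ball_involution_ball_aut[OF a], of "ball_involution a z"]
    by (simp add: z a ball_involution_in_ball ball_involution_involution)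
  with A(1) a that show thesis by blast
qed

text \<open>
  The quotient of \<open>(cmod (1 - hip z w))\<^sup>2\<close> by \<open>(1 - (norm z)\<^sup>2) *
  (1 - (norm w)\<^sup>2)\<close> is the squared hyperbolic cosine of the Bergman distance of
  \<open>z\<close> and \<open>w\<close>, in a suitable normalisation. Its invariance is written
  without division.
\<close>

proposition ball_aut_invariant:
  assumes g: "g \<in> ball_aut" and z: "norm z < 1" and w: "norm w < 1"
  shows "(cmod (1 - hip (g z) (g w)))\<^sup>2 * ((1 - (norm z)\<^sup>2) * (1 - (norm w)\<^sup>2)) =
    (cmod (1 - hip z w))\<^sup>2 * ((1 - (norm (g z))\<^sup>2) * (1 - (norm (g w))\<^sup>2))"
proof -
  obtain A a where A: "unitary_matrix A" and a: "norm a < 1"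
    and gA: "\<And>z. norm z < 1 \<Longrightarrow> g z = A *v ball_involution a z"
    using ball_aut_decomposition[OF g] by blast
  have 1: "cmod (1 - hip a w) = cmod (1 - hip w a)"
    by (metis cnj_hip complex_cnj_diff complex_cnj_one complex_mod_cnj)
  have "1 - hip a a = of_real (1 - (norm a)\<^sup>2)" by (simp add: hip_self)
  then have 2: "cmod (1 - hip a a) = 1 - (norm a)\<^sup>2"
    using one_minus_hip_self_pos[OF a] by (simp only: norm_of_real abs_of_pos)
  have "cmod (1 - hip z a) > 0" "cmod (1 - hip w a) > 0"
    using hip_neq_1[OF z a] hip_neq_1[OF w a] by simp_all
  then show ?thesis
    unfolding gA[OF z] gA[OF w] norm_unitary[OF A] hip_unitary[OF A]
      norm_ball_involution[OF a z] norm_ball_involution[OF a w] hip_ball_involution[OF a z w] norm_divide norm_mult 1 2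
    by (simp add: power2_eq_square mult_ac)
qed

section \<open>Circumcentres in the ball\<close>

lemma separation_bound_invariant:
  assumes g: "g \<in> ball_aut" and z: "norm z < 1" and w: "norm w < 1"
  shows "(cmod (1 - hip (g z) (g w)))\<^sup>2 \<le> c * ((1 - (norm (g z))\<^sup>2) * (1 - (norm (g w))\<^sup>2)) \<longleftrightarrow>
    (cmod (1 - hip z w))\<^sup>2 \<le> c * ((1 - (norm z)\<^sup>2) * (1 - (norm w)\<^sup>2))"
    (is "?a \<le> c * ?P \<longleftrightarrow> ?b \<le> c * ?Q")
proof -
  have "norm (g z) < 1" "norm (g w) < 1" using ball_autD(3)[OF g] z w by auto
  then have P: "?P > 0" by (intro mult_pos_pos one_minus_hip_self_pos)
  have Q: "?Q > 0" using z w by (intro mult_pos_pos one_minus_hip_self_pos)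
  have eq: "?a * ?Q = ?b * ?P" by (rule ball_aut_invariant[OF g z w])
  have "?a \<le> c * ?P \<longleftrightarrow> ?a * ?Q \<le> (c * ?P) * ?Q" using Q by (simp only: mult_le_cancel_right_pos)
  also have "\<dots> \<longleftrightarrow> ?b * ?P \<le> (c * ?Q) * ?P" unfolding eq by (simp only: mult_ac)
  also have "\<dots> \<longleftrightarrow> ?b \<le> c * ?Q" using P by (simp only: mult_le_cancel_right_pos)
  finally show ?thesis .
qed

text \<open>
  Strict convexity of balls for the hyperbolic distance. Unit vectors of the form of signature
  \<open>(1, n)\<close> representing \<open>0\<close> and \<open>q\<close> are \<open>(1,
  0)\<close> and \<open>b * (1, q)\<close>. Their sum represents the midpoint \<open>w\<close>,
  and the triangle inequality bounds its pairing with \<open>v\<close> by the sum of the two given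
  bounds. Normalising the sum gains the factor \<open>t = 2 / (1 + b) < 1\<close>.
\<close>

lemma midpoint_closer:
  fixes q :: "complex ^ 'n"
  assumes q: "norm q < 1" "q \<noteq> 0"
  obtains w t where "norm w < 1" "0 < t" "t < 1"
    "\<And>v c. \<lbrakk>norm v < 1; (cmod (1 - hip 0 v))\<^sup>2 \<le> c * ((1 - (norm (0 :: complex ^ 'n))\<^sup>2) * (1 - (norm v)\<^sup>2));
        (cmod (1 - hip q v))\<^sup>2 \<le> c * ((1 - (norm q)\<^sup>2) * (1 - (norm v)\<^sup>2))\<rbrakk>
      \<Longrightarrow> (cmod (1 - hip w v))\<^sup>2 \<le> (t * c) * ((1 - (norm w)\<^sup>2) * (1 - (norm v)\<^sup>2))"
proof
  \<comment> \<open>The point \<open>(1, q)\<close> in homogeneous coordinates becomes a unit vector after multiplication by \<open>b\<close>.\<close>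
  define b where "b = 1 / sqrt (1 - (norm q)\<^sup>2)"
  have q1: "1 - (norm q)\<^sup>2 > 0" "1 - (norm q)\<^sup>2 < 1" using q one_minus_hip_self_pos by auto
  then have sq: "0 < sqrt (1 - (norm q)\<^sup>2)" "sqrt (1 - (norm q)\<^sup>2) < 1" by (auto simp: real_sqrt_lt_1_iff)
  have b: "b > 1" using sq by (simp add: b_def)
  have b2: "b\<^sup>2 * (1 - (norm q)\<^sup>2) = 1" using q1 by (simp add: b_def power_divide)
  define w where "w = of_real (b / (1 + b)) *s q"
  define t where "t = 2 / (1 + b)"
  show "0 < t" "t < 1" using b by (simp_all add: t_def)
  have "norm w = b / (1 + b) * norm q" unfolding w_def norm_csmult norm_of_real using b by simp
  then have w2: "1 - (norm w)\<^sup>2 = t"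
  proof -
    assume "norm w = b / (1 + b) * norm q"
    then have "(norm w)\<^sup>2 = (b\<^sup>2 * (norm q)\<^sup>2) / (1 + b)\<^sup>2" by (simp add: power_mult_distrib power_divide)
    also have "b\<^sup>2 * (norm q)\<^sup>2 = (b - 1) * (1 + b)"
    proof -
      have "b\<^sup>2 - b\<^sup>2 * (norm q)\<^sup>2 = 1" using b2 by (simp only: right_diff_distrib mult_1_right)
      moreover have "(b - 1) * (1 + b) = b\<^sup>2 - 1" by (simp add: algebra_simps power2_eq_square)
      ultimately show ?thesis by linarith
    qed
    also have "1 - (b - 1) * (1 + b) / (1 + b)\<^sup>2 = t"
      using b by (simp add: t_def power2_eq_square divide_simps)
    finally show ?thesis by simp
  qed
  then show "norm w < 1" using \<open>0 < t\<close>
    by (metis abs_square_less_1 abs_norm_cancel diff_gt_0_iff_gt)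
  fix v c assume v: "norm v < 1"
    and 0: "(cmod (1 - hip 0 v))\<^sup>2 \<le> c * ((1 - (norm (0 :: complex ^ 'n))\<^sup>2) * (1 - (norm v)\<^sup>2))"
    and 1: "(cmod (1 - hip q v))\<^sup>2 \<le> c * ((1 - (norm q)\<^sup>2) * (1 - (norm v)\<^sup>2))"
  define R where "R = sqrt (c * (1 - (norm v)\<^sup>2))"
  have R1: "1 \<le> R" using 0 by (simp add: R_def)
  then have R2: "R\<^sup>2 = c * (1 - (norm v)\<^sup>2)"
    using 0 by (simp add: R_def)
  have "(b * cmod (1 - hip q v))\<^sup>2 \<le> b\<^sup>2 * (c * ((1 - (norm q)\<^sup>2) * (1 - (norm v)\<^sup>2)))"
    unfolding power_mult_distrib using 1 by (intro mult_left_mono) auto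
  also have "\<dots> = (b\<^sup>2 * (1 - (norm q)\<^sup>2)) * R\<^sup>2" unfolding R2 by (simp only: mult_ac)
  also have "\<dots> = R\<^sup>2" by (simp add: b2)
  finally have bR: "b * cmod (1 - hip q v) \<le> R" using R1 by (simp add: power2_le_iff_abs_le)
  have "of_real (1 + b) * (1 - hip w v) = 1 + of_real b * (1 - hip q v)"
  proof -
    have "complex_of_real (1 + b) * of_real (b / (1 + b)) = of_real b"
      unfolding of_real_mult[symmetric] using b by simp
    then have "complex_of_real (1 + b) * (of_real (b / (1 + b)) * hip q v) = of_real b * hip q v"
      by (simp only: mult.assoc[symmetric])
    then show ?thesis unfolding w_def hip_simps right_diff_distrib by simp
  qed
  from arg_cong[OF this, of cmod]
  have "(1 + b) * cmod (1 - hip w v) = cmod (1 + of_real b * (1 - hip q v))"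
    unfolding norm_mult norm_of_real using b by simp
  also have "\<dots> \<le> 1 + b * cmod (1 - hip q v)"
    using norm_triangle_ineq[of 1 "of_real b * (1 - hip q v)"] b by (simp add: norm_mult)
  also have "\<dots> \<le> 2 * R" using R1 bR by simp
  finally have "cmod (1 - hip w v) \<le> t * R" using b by (simp add: t_def field_simps)
  then have "(cmod (1 - hip w v))\<^sup>2 \<le> (t * R)\<^sup>2" by (intro power_mono) auto
  also have "\<dots> = (t * c) * (t * (1 - (norm v)\<^sup>2))"
    by (simp add: power_mult_distrib R2 power2_eq_square[of t])
  finally show "(cmod (1 - hip w v))\<^sup>2 \<le> (t * c) * ((1 - (norm w)\<^sup>2) * (1 - (norm v)\<^sup>2))" by (simp only: w2)
qed

lemma ball_involution_self: "norm a < 1 \<Longrightarrow> ball_involution a a = 0"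
  using ball_involution_involution[of a 0] by simp

text \<open>
  The set \<open>T\<close> lies in the closed hyperbolic ball with centre \<open>w\<close> for
  which the squared hyperbolic cosine of the radius is \<open>c\<close>.
\<close>

definition hyperbolically_within :: "(complex ^ 'n) set \<Rightarrow> real \<Rightarrow> complex ^ 'n \<Rightarrow> bool" where
  "hyperbolically_within T c w \<longleftrightarrow> norm w < 1 \<and>
     (\<forall>v\<in>T. (cmod (1 - hip w v))\<^sup>2 \<le> c * ((1 - (norm w)\<^sup>2) * (1 - (norm v)\<^sup>2)))"

text \<open>
  A smallest radius exists because the admissible pairs of centre and radius form a compact set:
  the point \<open>0\<close> of \<open>T\<close> keeps the centres away from the sphere. The
  centre for it is unique, because between two centres the midpoint would do with a smaller
  radius; an involution moves one of the two to \<open>0\<close>, where the midpoint has been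
  computed.
\<close>

lemma circumcentre:
  fixes T :: "(complex ^ 'n) set"
  assumes T: "compact T" "T \<subseteq> ball 0 1" "0 \<in> T"
  shows "\<exists>c p. hyperbolically_within T c p \<and> (\<forall>q. hyperbolically_within T c q \<longrightarrow> q = p)"
proof -
  have T1: "norm v < 1" if "v \<in> T" for v using T(2) that by auto
  obtain v0 where v0: "v0 \<in> T" "\<And>v. v \<in> T \<Longrightarrow> norm v \<le> norm v0"
    using continuous_attains_sup[OF T(1), of norm] T(3) by (auto intro: continuous_intros)
  \<comment> \<open>The value for which the centre \<open>0\<close> is admissible; it bounds the search for the minimum.\<close>
  define c0 where "c0 = 1 / (1 - (norm v0)\<^sup>2)"
  have c0: "c0 > 0" using one_minus_hip_self_pos[OF T1[OF v0(1)]] by (simp add: c0_def)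
  define X where "X = cball (0::complex ^ 'n) 1 \<times> {0..c0} \<inter>
     (\<Inter>v\<in>T. {(w, c). (cmod (1 - hip w v))\<^sup>2 \<le> c * ((1 - (norm w)\<^sup>2) * (1 - (norm v)\<^sup>2))})"
  have "compact X"
    unfolding X_def
  proof (rule compact_Int_closed)
    show "compact (cball (0::complex ^ 'n) 1 \<times> {0..c0})"
      by (intro compact_Times compact_cball compact_Icc)
    show "closed (\<Inter>v\<in>T. {(w, c). (cmod (1 - hip w v))\<^sup>2 \<le> c * ((1 - (norm w)\<^sup>2) * (1 - (norm v)\<^sup>2))})"
      unfolding case_prod_beta hip_def
      by (intro closed_INT ballI closed_Collect_le continuous_intros)
  qed
  moreover have "(0, c0) \<in> X"
  proof -
    have "1 \<le> c0 * (1 - (norm v)\<^sup>2)" if "v \<in> T" for v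
    proof -
      have "(norm v)\<^sup>2 \<le> (norm v0)\<^sup>2" using v0(2)[OF that] by (intro power_mono) auto
      then show ?thesis
        using one_minus_hip_self_pos[OF T1[OF v0(1)]] by (simp add: c0_def field_simps)
    qed
    then show ?thesis using c0 by (simp add: X_def)
  qed
  ultimately obtain p c where pc: "(p, c) \<in> X" and min: "\<And>q d. (q, d) \<in> X \<Longrightarrow> c \<le> d"
    using continuous_attains_inf[of X snd] by (force intro: continuous_intros)
  \<comment> \<open>The condition for the point \<open>0\<close> of \<open>T\<close>.\<close>
  have bound: "1 \<le> c * (1 - (norm p)\<^sup>2)"
    using pc T(3) by (force simp: X_def)
  have c: "0 < c" "c \<le> c0"
    using pc bound by (auto simp: X_def order_le_less)
  have p: "norm p < 1"
  proof -
    have "0 < 1 - (norm p)\<^sup>2" using bound c(1) by (metis less_le_trans zero_less_one zero_less_mult_pos)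
    then show ?thesis by (simp add: abs_square_less_1)
  qed
  show ?thesis
  proof (intro exI conjI allI impI)
    show "hyperbolically_within T c p" using pc p by (auto simp: hyperbolically_within_def X_def)
    fix q assume q: "hyperbolically_within T c q"
    show "q = p"
    proof (rule ccontr)
      assume ne: "q \<noteq> p"
      let ?g = "restrict (ball_involution p) (ball 0 1)"
      note g = ball_involution_ball_aut[OF p]
      have q1: "norm q < 1" using q by (simp add: hyperbolically_within_def)
      have "ball_involution p q \<noteq> 0"
        using ball_involution_involution[OF p q1] ne by auto
      from midpoint_closer[OF ball_involution_in_ball[OF p q1] this]
      obtain w t where w: "norm w < 1" and t: "0 < t" "t < 1" and closer:
        "\<And>v c. \<lbrakk>norm v < 1; (cmod (1 - hip 0 v))\<^sup>2 \<le> c * ((1 - (norm (0 :: complex ^ 'n))\<^sup>2) * (1 - (norm v)\<^sup>2));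
            (cmod (1 - hip (ball_involution p q) v))\<^sup>2 \<le> c * ((1 - (norm (ball_involution p q))\<^sup>2) * (1 - (norm v)\<^sup>2))\<rbrakk>
          \<Longrightarrow> (cmod (1 - hip w v))\<^sup>2 \<le> (t * c) * ((1 - (norm w)\<^sup>2) * (1 - (norm v)\<^sup>2))" by blast
      have "hyperbolically_within T (t * c) (ball_involution p w)"
        unfolding hyperbolically_within_def
      proof (intro conjI ballI)
        show "norm (ball_involution p w) < 1" by (rule ball_involution_in_ball[OF p w])
        fix v assume v: "v \<in> T"
        note v1 = T1[OF v]
        note inv = separation_bound_invariant[OF g]
        have "(cmod (1 - hip w (ball_involution p v)))\<^sup>2 \<le>
            (t * c) * ((1 - (norm w)\<^sup>2) * (1 - (norm (ball_involution p v))\<^sup>2))"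
        proof (rule closer)
          show "norm (ball_involution p v) < 1" by (rule ball_involution_in_ball[OF p v1])
          show "(cmod (1 - hip 0 (ball_involution p v)))\<^sup>2
              \<le> c * ((1 - (norm (0 :: complex ^ 'n))\<^sup>2) * (1 - (norm (ball_involution p v))\<^sup>2))"
            using inv[OF p v1, of c] \<open>hyperbolically_within T c p\<close> v p v1 by (simp add: hyperbolically_within_def ball_involution_self)
          show "(cmod (1 - hip (ball_involution p q) (ball_involution p v)))\<^sup>2
              \<le> c * ((1 - (norm (ball_involution p q))\<^sup>2) * (1 - (norm (ball_involution p v))\<^sup>2))"
            using inv[OF q1 v1, of c] q v q1 v1 by (simp add: hyperbolically_within_def)
        qed
        then show "(cmod (1 - hip (ball_involution p w) v))\<^sup>2 \<le> (t * c) * ((1 - (norm (ball_involution p w))\<^sup>2) * (1 - (norm v)\<^sup>2))"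
          using inv[OF w ball_involution_in_ball[OF p v1], of "t * c"] p v1 w
          by (simp add: ball_involution_in_ball ball_involution_involution)
      qed
      moreover have tc: "t * c < c" using t c by simp
      ultimately have "(ball_involution p w, t * c) \<in> X"
        using mult_pos_pos[OF t(1) c(1)] less_le_trans[OF tc c(2)] unfolding hyperbolically_within_def X_def by simp
      then show False using min \<open>t * c < c\<close> by (meson not_le)
    qed
  qed
qed

text \<open>
  The image of the circumcentre under an element of \<open>K\<close> is a circumcentre of the same
  set, so uniqueness makes it a fixed point.
\<close>

lemma common_fixed_point_if_invariant_compact_set:
  fixes T :: "(complex ^ 'n) set"
  assumes K: "K \<subseteq> ball_aut" and T: "compact T" "T \<subseteq> ball 0 1" "0 \<in> T"
    and inv: "\<And>k v. k \<in> K \<Longrightarrow> v \<in> T \<Longrightarrow> (inv\<^bsub>ball_aut_group\<^esub> k) v \<in> T"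
  obtains p where "norm p < 1" "\<And>k. k \<in> K \<Longrightarrow> k p = p"
proof -
  obtain c p where p: "hyperbolically_within T c p"
    and unique: "\<forall>q. hyperbolically_within T c q \<longrightarrow> q = p"
    using circumcentre[OF T] by blast
  have p1: "norm p < 1" using p by (simp add: hyperbolically_within_def)
  have "k p = p" if "k \<in> K" for k
  proof (rule unique[rule_format], unfold hyperbolically_within_def, intro conjI ballI)
    have k: "k \<in> ball_aut" using that K by blast
    show "norm (k p) < 1" using ball_autD(3)[OF k, of p] p1 by simp
    fix v assume v: "v \<in> T"
    let ?u = "(inv\<^bsub>ball_aut_group\<^esub> k) v"
    have u: "?u \<in> T" by (rule inv[OF that v])
    have "norm v < 1" "norm ?u < 1" using T(2) u v by (meson mem_ball_0 subsetD)+
    then show "(cmod (1 - hip (k p) v))\<^sup>2 \<le> c * ((1 - (norm (k p))\<^sup>2) * (1 - (norm v)\<^sup>2))"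
      using separation_bound_invariant[OF k p1, of ?u c] p u ball_aut_inverse(4)[OF k, of v]
      by (simp add: hyperbolically_within_def)
  qed
  with p1 that show thesis by blast
qed

section \<open>Maximal compact subgroups\<close>

text \<open>
  Conjugating by \<open>\<phi>\<close> turns the stabilizer of the origin, which is the unitary
  group by Cartan's theorem, into the stabilizer of \<open>\<phi> 0\<close>.
\<close>

lemma conjugate_of_unitary_auts_eq:
  assumes phi: "\<phi> \<in> ball_aut"
  shows "conjugate_of_unitary_auts \<phi> = {g \<in> ball_aut. g (\<phi> 0) = \<phi> 0}"
proof -
  let ?i = "inv\<^bsub>ball_aut_group\<^esub> \<phi>"
  note i = ball_aut_inverse(1)[OF phi]
  have conj: "(\<phi> \<otimes>\<^bsub>ball_aut_group\<^esub> u \<otimes>\<^bsub>ball_aut_group\<^esub> ?i) \<in> ball_aut"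
    "\<And>z. z \<in> ball 0 1 \<Longrightarrow> (\<phi> \<otimes>\<^bsub>ball_aut_group\<^esub> u \<otimes>\<^bsub>ball_aut_group\<^esub> ?i) z = \<phi> (u (?i z))"
    if "u \<in> ball_aut" for u
    using that phi i by (simp_all add: ball_aut_mult ball_aut_inverse(2) del: mem_ball mem_ball_0)
  show ?thesis
  proof (intro equalityI subsetI)
    fix g assume "g \<in> conjugate_of_unitary_auts \<phi>"
    then obtain A where A: "unitary_matrix A"
      and g: "g = \<phi> \<otimes>\<^bsub>ball_aut_group\<^esub> restrict (\<lambda>z. A *v z) (ball 0 1) \<otimes>\<^bsub>ball_aut_group\<^esub> ?i"
      unfolding conjugate_of_unitary_auts_def unitary_auts_def by blast
    have "\<phi> 0 \<in> ball 0 1" by (rule ball_autD(3)[OF phi]) simp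
    then show "g \<in> {g \<in> ball_aut. g (\<phi> 0) = \<phi> 0}"
      using conj[OF unitary_ball_aut[OF A]] ball_aut_inverse(3)[OF phi, of 0]
      unfolding g by (simp del: mem_ball mem_ball_0 add: centre_in_ball)
  next
    fix g assume "g \<in> {g \<in> ball_aut. g (\<phi> 0) = \<phi> 0}"
    then have g: "g \<in> ball_aut" and fix_pt: "g (\<phi> 0) = \<phi> 0" by auto
    let ?u = "?i \<otimes>\<^bsub>ball_aut_group\<^esub> g \<otimes>\<^bsub>ball_aut_group\<^esub> \<phi>"
    have u: "?u \<in> ball_aut" "\<And>z. z \<in> ball 0 1 \<Longrightarrow> ?u z = ?i (g (\<phi> z))"
      using phi i g by (simp_all add: ball_aut_mult ball_autD(3) del: mem_ball mem_ball_0)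
    have "?u 0 = 0" using u(2)[of 0] fix_pt ball_aut_inverse(3)[OF phi, of 0] by simp
    from ball_aut_fixing_0_unitary[OF u(1) this]
    obtain A where A: "unitary_matrix A" "\<And>z. z \<in> ball 0 1 \<Longrightarrow> ?u z = A *v z" by blast
    have "?u = restrict (\<lambda>z. A *v z) (ball 0 1)"
      by (rule ball_aut_eqI[OF u(1) unitary_ball_aut[OF A(1)]]) (simp add: A(2) del: mem_ball mem_ball_0)
    then have "?u \<in> unitary_auts" using A(1) by (auto simp: unitary_auts_def)
    moreover have "g = \<phi> \<otimes>\<^bsub>ball_aut_group\<^esub> ?u \<otimes>\<^bsub>ball_aut_group\<^esub> ?i"
    proof (rule ball_aut_eqI[OF g conj(1)[OF u(1)]])
      fix z :: "complex ^ 'a" assume z: "z \<in> ball 0 1"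
      then show "g z = (\<phi> \<otimes>\<^bsub>ball_aut_group\<^esub> ?u \<otimes>\<^bsub>ball_aut_group\<^esub> ?i) z"
        using conj(2)[OF u(1) z] u(2)[OF ball_aut_inverse(2)[OF phi z]]
        by (simp add: ball_aut_inverse[OF phi] ball_autD(3)[OF g] del: mem_ball mem_ball_0)
    qed
    ultimately show "g \<in> conjugate_of_unitary_auts \<phi>"
      unfolding conjugate_of_unitary_auts_def by blast
  qed
qed

lemma stabilizer_eq_conjugate:
  assumes "norm p < 1"
  shows "\<exists>\<phi>\<in>ball_aut. conjugate_of_unitary_auts \<phi> = {g \<in> ball_aut. g p = p}"
  by (rule bexI[OF _ ball_involution_ball_aut[OF assms]])
    (simp add: conjugate_of_unitary_auts_eq[OF ball_involution_ball_aut[OF assms]])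

lemma subgroup_stabilizer:
  assumes p: "p \<in> ball 0 1"
  shows "subgroup {g \<in> ball_aut. g p = p} ball_aut_group"
proof (rule group.subgroupI[OF group_ball_aut_group])
  show "{g \<in> ball_aut. g p = p} \<noteq> {}" using ball_aut_one p by (auto simp del: mem_ball mem_ball_0)
  show "inv\<^bsub>ball_aut_group\<^esub> g \<in> {g \<in> ball_aut. g p = p}" if "g \<in> {g \<in> ball_aut. g p = p}" for g
    using that ball_aut_inverse(3)[of g p] p by (auto simp del: mem_ball mem_ball_0 intro: ball_aut_inverse(1))
qed (use p in \<open>auto simp: ball_aut_mult simp del: mem_ball mem_ball_0\<close>)

lemma compact_unitary_matrices: "compact {A :: complex ^ 'n ^ 'n. unitary_matrix A}"
proof (rule compact_eq_bounded_closed[THEN iffD2], intro conjI)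
  have "norm A \<le> real (CARD('n) * CARD('n))" if A: "unitary_matrix A" for A :: "complex ^ 'n ^ 'n"
  proof -
    have entry: "cmod (A $ i $ j) \<le> 1" for i j
    proof -
      have "A $ i $ j = (A *v axis j 1) $ i"
        by (simp add: matrix_vector_mult_def axis_def if_distrib cong: if_cong)
      also have "\<dots> = hip (A *v axis j 1) (axis i 1)" by (simp only: hip_axis)
      also have "cmod \<dots> \<le> norm (A *v axis j 1) * norm (axis i 1 :: complex ^ 'n)"
        by (rule hip_Cauchy_Schwarz)
      finally show ?thesis using A by (simp add: norm_unitary)
    qed
    have "norm A \<le> (\<Sum>i\<in>UNIV. norm (A $ i))"
      unfolding norm_vec_def[of A] by (rule L2_set_le_sum) auto
    also have "\<dots> \<le> (\<Sum>i\<in>(UNIV :: 'n set). \<Sum>j\<in>(UNIV :: 'n set). cmod (A $ i $ j))"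
      by (intro sum_mono) (simp add: norm_vec_def[of "A $ _"] L2_set_le_sum)
    also have "\<dots> \<le> (\<Sum>i\<in>(UNIV :: 'n set). \<Sum>j\<in>(UNIV :: 'n set). 1)"
      by (intro sum_mono entry)
    finally show ?thesis by simp
  qed
  then show "bounded {A :: complex ^ 'n ^ 'n. unitary_matrix A}" by (auto simp: bounded_iff)
  have "{A :: complex ^ 'n ^ 'n. unitary_matrix A} =
    {A. \<forall>i j. (\<Sum>k\<in>UNIV. cnj (A $ k $ i) * A $ k $ j) = (if i = j then 1 else 0)}"
  proof -
    have "unitary_matrix A \<longleftrightarrow> conjugate_transpose A ** A = mat 1" for A :: "complex ^ 'n ^ 'n"
      unfolding unitary_matrix_def using matrix_left_right_inverse by blast
    then show ?thesis
      by (simp add: matrix_matrix_mult_def conjugate_transpose_def mat_def vec_eq_iff)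
  qed
  also have "closed \<dots>"
    by (intro closed_Collect_all closed_Collect_eq continuous_intros)
  finally show "closed {A :: complex ^ 'n ^ 'n. unitary_matrix A}" .
qed

lemma ball_aut_continuous: "g \<in> ball_aut \<Longrightarrow> continuous_on (ball 0 1) g"
  using ball_autD(2)[of g] unfolding holomorphic_map_on_def
  by (meson continuous_at_imp_continuous_on has_derivative_continuous)

text \<open>
  The conjugate is the image of the compact set of unitary matrices. The parametrisation is
  continuous into the compact-open topology because the action is jointly continuous: for compact
  \<open>C\<close> and open \<open>V\<close>, the matrices that move some point of
  \<open>C\<close> out of \<open>V\<close> are the projection of a compact subset of the product
  with \<open>C\<close>.
\<close>

lemma compact_conjugate_of_unitary_auts:
  fixes \<phi> :: "complex ^ 'n \<Rightarrow> complex ^ 'n"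
  assumes phi: "\<phi> \<in> ball_aut"
  shows "compactin ball_aut_topology (conjugate_of_unitary_auts \<phi>)"
proof -
  let ?i = "inv\<^bsub>ball_aut_group\<^esub> \<phi>"
  let ?U = "{A :: complex ^ 'n ^ 'n. unitary_matrix A}"
  define F where "F = (\<lambda>A :: complex ^ 'n ^ 'n.
    \<phi> \<otimes>\<^bsub>ball_aut_group\<^esub> restrict (\<lambda>z. A *v z) (ball 0 1) \<otimes>\<^bsub>ball_aut_group\<^esub> ?i)"
  note i = ball_aut_inverse(1)[OF phi]
  have F: "F A \<in> ball_aut" "\<And>z. z \<in> ball 0 1 \<Longrightarrow> F A z = \<phi> (A *v ?i z)" if "A \<in> ?U" for A
    using that phi i unfolding F_def
    by (simp_all add: unitary_ball_aut ball_aut_mult ball_aut_inverse(2) del: mem_ball mem_ball_0)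
  have "continuous_map (top_of_set ?U) ball_aut_topology F"
    unfolding ball_aut_topology_def continuous_on_generated_topo_iff
  proof (intro conjI allI impI)
    show "F ` topspace (top_of_set ?U)
        \<subseteq> \<Union>{{\<gamma> \<in> ball_aut. \<gamma> ` C \<subseteq> V} | C V. compact C \<and> C \<subseteq> ball 0 1 \<and> open V}"
      using F(1) by (auto intro!: exI[of _ "ball_aut"] exI[of _ "{}"])
    fix W assume "W \<in> {{\<gamma> \<in> ball_aut. \<gamma> ` C \<subseteq> V} | (C :: (complex ^ 'n) set) (V :: (complex ^ 'n) set).
      compact C \<and> C \<subseteq> ball 0 1 \<and> open V}"
    then obtain C V :: "(complex ^ 'n) set" where W: "W = {\<gamma> \<in> ball_aut. \<gamma> ` C \<subseteq> V}"
      and C: "compact C" "C \<subseteq> ball 0 1" and V: "open V" by blast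
    \<comment> \<open>The matrices outside the preimage of \<open>W\<close> are the projection of a compact set.\<close>
    define G where "G = (\<lambda>(A, z). \<phi> (A *v ?i z))"
    have cont: "continuous_on (?U \<times> C) G"
      unfolding G_def case_prod_beta
    proof (rule continuous_on_compose2[OF ball_aut_continuous[OF phi]])
      have "continuous_on (?U \<times> C) (\<lambda>x. ?i (snd x))"
        by (rule continuous_on_compose2[OF ball_aut_continuous[OF i]])
          (use C in \<open>auto intro!: continuous_intros simp del: mem_ball mem_ball_0\<close>)
      then show "continuous_on (?U \<times> C) (\<lambda>x. fst x *v ?i (snd x))"
        unfolding matrix_vector_mult_def by (intro continuous_intros)
      show "(\<lambda>x. fst x *v ?i (snd x)) ` (?U \<times> C) \<subseteq> ball 0 1"
        using C(2) ball_aut_inverse(2)[OF phi] by (auto simp: norm_unitary)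
    qed
    have "closedin (top_of_set (?U \<times> C)) {x \<in> ?U \<times> C. G x \<in> - V}"
      using continuous_closedin_preimage[OF cont, of "- V"] V
      by (simp add: closed_def vimage_def Int_def)
    then have "compact {x \<in> ?U \<times> C. G x \<in> - V}"
      by (rule closedin_compact[OF compact_Times[OF compact_unitary_matrices C(1)]])
    then have "compact (fst ` {x \<in> ?U \<times> C. G x \<in> - V})"
      by (intro compact_continuous_image continuous_intros)
    then have "closed (fst ` {x \<in> ?U \<times> C. G x \<in> - V})" by (rule compact_imp_closed)
    moreover have "F -` W \<inter> topspace (top_of_set ?U) = ?U \<inter> - (fst ` {x \<in> ?U \<times> C. G x \<in> - V})"
    proof -
      have "F A ` C \<subseteq> V \<longleftrightarrow> (\<forall>z\<in>C. G (A, z) \<in> V)" if "A \<in> ?U" for A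
        using F(2)[OF that] C(2) by (auto simp: G_def image_subset_iff subset_iff simp del: mem_ball mem_ball_0)
      then have "F A \<in> W \<longleftrightarrow> (\<forall>z\<in>C. G (A, z) \<in> V)" if "A \<in> ?U" for A
        using that F(1)[OF that] unfolding W by blast
      moreover have "A \<in> fst ` {x \<in> ?U \<times> C. G x \<in> - V} \<longleftrightarrow> \<not> (\<forall>z\<in>C. G (A, z) \<in> V)" if "A \<in> ?U" for A
        using that by force
      ultimately show ?thesis by auto
    qed
    ultimately show "openin (top_of_set ?U) (F -` W \<inter> topspace (top_of_set ?U))"
      by (simp add: openin_open_Int open_Compl)
  qed
  moreover have "compactin (top_of_set ?U) ?U"
    using compact_unitary_matrices by (simp add: compactin_subtopology)
  ultimately have "compactin ball_aut_topology (F ` ?U)" by (rule image_compactin[rotated])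
  moreover have "F ` ?U = conjugate_of_unitary_auts \<phi>"
    unfolding conjugate_of_unitary_auts_def unitary_auts_def F_def by auto
  ultimately show ?thesis by simp
qed

lemma compact_subgroup_subset:
  assumes "compact_subgroup K" shows "K \<subseteq> ball_aut"
proof -
  have "subgroup K ball_aut_group" using assms by (simp add: compact_subgroup_def)
  from subgroup.subset[OF this] show ?thesis by simp
qed

text \<open>
  The orbit of the origin is compact and invariant under the group.
\<close>

lemma compact_subgroup_has_fixed_point:
  fixes K :: "(complex ^ 'n \<Rightarrow> complex ^ 'n) set"
  assumes "compact_subgroup K"
  shows "\<exists>p. norm p < 1 \<and> (\<forall>k\<in>K. k p = p)"
proof -
  have sub: "subgroup K ball_aut_group" and comp: "compactin ball_aut_topology K"
    using assms by (auto simp: compact_subgroup_def)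
  have K: "K \<subseteq> ball_aut" using subgroup.subset[OF sub] by simp
  have "continuous_map ball_aut_topology euclidean (\<lambda>g. g (0 :: complex ^ 'n))"
    unfolding continuous_map_def topspace_ball_aut_topology
  proof (intro conjI allI impI)
    fix V :: "(complex ^ 'n) set" assume "openin euclidean V"
    then have "{g \<in> ball_aut. g ` {0} \<subseteq> V} \<in>
      {{\<gamma> \<in> ball_aut. \<gamma> ` C \<subseteq> V} | (C :: (complex ^ 'n) set) (V :: (complex ^ 'n) set). compact C \<and> C \<subseteq> ball 0 1 \<and> open V}"
      by (intro CollectI exI[of _ "{0}"] exI[of _ V]) auto
    moreover have "{g \<in> ball_aut. g ` {0} \<subseteq> V} = {g \<in> ball_aut. g 0 \<in> V}" by auto
    ultimately show "openin ball_aut_topology {g \<in> ball_aut. g 0 \<in> V}"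
      unfolding ball_aut_topology_def by (metis (no_types, lifting) topology_generated_by_Basis)
  qed auto
  from image_compactin[OF comp this] have T: "compact ((\<lambda>g. g 0) ` K)" by simp
  show ?thesis
  proof (rule common_fixed_point_if_invariant_compact_set[OF K T])
    show "(\<lambda>g. g 0) ` K \<subseteq> ball 0 1"
      using ball_autD(3)[OF subsetD[OF K], of _ 0] by (simp add: image_subset_iff)
    show "0 \<in> (\<lambda>g. g 0) ` K"
    proof (rule image_eqI)
      show "\<one>\<^bsub>ball_aut_group\<^esub> \<in> K" by (rule subgroup.one_closed[OF sub])
      show "0 = \<one>\<^bsub>ball_aut_group\<^esub> (0 :: complex ^ 'n)" by (rule ball_aut_one(2)[symmetric]) simp
    qed
    show "(inv\<^bsub>ball_aut_group\<^esub> k) v \<in> (\<lambda>g. g 0) ` K" if k: "k \<in> K" and v: "v \<in> (\<lambda>g. g 0) ` K" for k v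
    proof -
      obtain g where g: "g \<in> K" "v = g 0" using v by blast
      have "inv\<^bsub>ball_aut_group\<^esub> k \<otimes>\<^bsub>ball_aut_group\<^esub> g \<in> K"
        using subgroup.m_closed[OF sub subgroup.m_inv_closed[OF sub k] g(1)] .
      moreover have "(inv\<^bsub>ball_aut_group\<^esub> k \<otimes>\<^bsub>ball_aut_group\<^esub> g) 0 = (inv\<^bsub>ball_aut_group\<^esub> k) v"
        using ball_aut_mult(2)[OF ball_aut_inverse(1), of k g 0] k g K by auto
      ultimately show ?thesis by (blast intro: image_eqI[OF sym])
    qed
  qed blast
qed

lemma compact_subgroup_conjugate: "\<phi> \<in> ball_aut \<Longrightarrow> compact_subgroup (conjugate_of_unitary_auts \<phi>)"
  unfolding compact_subgroup_def
  using compact_conjugate_of_unitary_auts[of \<phi>] subgroup_stabilizer[of "\<phi> 0"] ball_autD(3)[of \<phi> 0]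
  by (simp add: conjugate_of_unitary_auts_eq)

text \<open>
  A compact subgroup fixes a point, so it lies in the stabilizer of that point, which is a compact
  conjugate of the unitary group. No stabilizer is properly contained in another compact subgroup
  \<open>K'\<close>: a point fixed by \<open>K'\<close> is fixed by the stabilizer of
  \<open>\<phi> 0\<close>, in particular by the conjugate of \<open>-1\<close>, whose only fixed
  point is \<open>\<phi> 0\<close>.
\<close>

theorem maximal_compact_subgroup_iff_conjugate:
  "maximal_compact_subgroup K \<longleftrightarrow> (\<exists>\<phi>\<in>ball_aut. K = conjugate_of_unitary_auts \<phi>)"
proof
  assume K: "maximal_compact_subgroup K"
  then have cK: "compact_subgroup K" by (simp add: maximal_compact_subgroup_def)
  obtain p where p: "norm p < 1" "\<forall>k\<in>K. k p = p"
    using compact_subgroup_has_fixed_point[OF cK] by blast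
  obtain \<phi> where phi: "\<phi> \<in> ball_aut" "conjugate_of_unitary_auts \<phi> = {g \<in> ball_aut. g p = p}"
    using stabilizer_eq_conjugate[OF p(1)] by blast
  from compact_subgroup_subset[OF cK] have "K \<subseteq> conjugate_of_unitary_auts \<phi>" using p(2) unfolding phi(2) by blast
  then show "\<exists>\<phi>\<in>ball_aut. K = conjugate_of_unitary_auts \<phi>"
    using K phi(1) compact_subgroup_conjugate[OF phi(1)] unfolding maximal_compact_subgroup_def by blast
next
  assume "\<exists>\<phi>\<in>ball_aut. K = conjugate_of_unitary_auts \<phi>"
  then obtain \<phi> where phi: "\<phi> \<in> ball_aut" and K: "K = conjugate_of_unitary_auts \<phi>" by blast
  have "K' = K" if K': "compact_subgroup K'" and sub: "K \<subseteq> K'" for K'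
  proof -
    obtain q where q: "norm q < 1" "\<forall>k\<in>K'. k q = q"
      using compact_subgroup_has_fixed_point[OF K'] by blast
    let ?i = "inv\<^bsub>ball_aut_group\<^esub> \<phi>"
    \<comment> \<open>The conjugate of \<open>-1\<close> fixes no point but \<open>\<phi> 0\<close>.\<close>
    let ?u = "restrict (\<lambda>z. mat (- 1) *v z) (ball (0 :: complex ^ 'a) 1)"
    let ?k = "\<phi> \<otimes>\<^bsub>ball_aut_group\<^esub> ?u \<otimes>\<^bsub>ball_aut_group\<^esub> ?i"
    have um: "unitary_matrix (mat (- 1) :: complex ^ 'a ^ 'a)" by (rule unitary_matrix_scalar) simp
    have "?k \<in> K" unfolding K conjugate_of_unitary_auts_def unitary_auts_def using um by blast
    then have "?k q = q" using q sub by blast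
    moreover have iq: "?i q \<in> ball 0 1" using ball_aut_inverse(2)[OF phi] q(1) by simp
    then have "?k q = \<phi> (mat (- 1) *v ?i q)"
      using phi q(1) unitary_ball_aut[OF um] ball_aut_inverse(1)[OF phi]
      by (simp add: ball_aut_mult)
    ultimately have "?i (\<phi> (mat (- 1) *v ?i q)) = ?i q" by simp
    then have "mat (- 1) *v ?i q = ?i q"
      using ball_aut_inverse(3)[OF phi, of "mat (- 1) *v ?i q"] iq norm_unitary[OF um] by simp
    moreover have "mat (- 1) *v v = - v" for v :: "complex ^ 'a"
      by (simp add: mat_def matrix_vector_mult_def vec_eq_iff if_distrib if_distribR cong: if_cong)
    ultimately have "- ?i q = ?i q" by simp
    then have "?i q = 0" by (simp add: vec_eq_iff)
    then have "q = \<phi> 0" using ball_aut_inverse(4)[OF phi, of q] q(1) by simp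
    moreover note compact_subgroup_subset[OF K']
    ultimately have "K' \<subseteq> K" unfolding K conjugate_of_unitary_auts_eq[OF phi] using q(2) by blast
    with sub show ?thesis by blast
  qed
  then show "maximal_compact_subgroup K"
    using compact_subgroup_conjugate[OF phi] unfolding maximal_compact_subgroup_def K by blast
qed

section \<open>Extension of isometries to unitary maps\<close>

text \<open>
  The reflection along \<open>d = a - a'\<close> that multiplies \<open>d\<close> by a suitable
  unimodular number. The scalar \<open>t\<close> is forced by \<open>W *v a = a'\<close>; that it
  makes \<open>W\<close> unitary is the condition \<open>t + cnj t = t * cnj t * hip d d\<close>,
  which amounts to \<open>norm a = norm a'\<close>. Vectors with the same product against
  \<open>a\<close> and \<open>a'\<close> are orthogonal to \<open>d\<close>, hence fixed.
\<close>

lemma complex_reflection_exists: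
  fixes a a' :: "complex ^ 'n"
  assumes "norm a = norm a'"
  shows "\<exists>W. unitary_matrix W \<and> W *v a = a' \<and> (\<forall>b. hip a b = hip a' b \<longrightarrow> W *v b = b)"
proof (cases "a = a'")
  case True
  show ?thesis
    by (rule exI[of _ "mat 1"]) (simp add: True unitary_matrix_scalar)
next
  case False
  define d where "d = a - a'"
  define t where "t = 1 / hip a d"
  define W where "W = mat 1 - (\<chi> i j. t * d $ i * cnj (d $ j))"
  have W: "W *v x = x - (t * hip x d) *s d" for x
    unfolding W_def matrix_vector_mult_diff_rdistrib matrix_vector_mul_lid
    by (simp add: matrix_vector_mult_def hip_def vec_eq_iff sum_distrib_left sum_distrib_right mult_ac)
  have aa: "hip a' a' = hip a a" using assms by (simp add: hip_self)
  have dd: "hip d d = hip a d + cnj (hip a d)"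
    by (simp add: d_def cnj_hip aa)
  have "d \<noteq> 0" using False by (simp add: d_def)
  then have "hip d d \<noteq> 0" by (simp only: hip_self_eq_0 not_False_eq_True)
  then have ad: "hip a d \<noteq> 0" using dd by auto
  have t: "t + cnj t = t * cnj t * hip d d"
    using ad by (simp add: t_def dd divide_simps)
  show ?thesis
  proof (intro exI conjI allI impI)
    show "unitary_matrix W"
    proof (rule unitary_matrixI)
      fix x y
      have "hip (W *v x) (W *v y) =
          hip x y - (t + cnj t) * hip x d * hip d y + t * cnj t * hip d d * hip x d * hip d y"
        by (simp add: W cnj_hip algebra_simps)
      then show "hip (W *v x) (W *v y) = hip x y" by (simp add: t)
    qed
    show "W *v a = a'" using ad by (simp add: W t_def d_def)
    show "W *v b = b" if "hip a b = hip a' b" for b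
    proof -
      have "hip d b = 0" using that by (simp add: d_def)
      then have "hip b d = 0" by (metis cnj_hip complex_cnj_zero)
      then show ?thesis by (simp add: W)
    qed
  qed
qed

text \<open>
  Reflections correct one vector at a time: by equality of the Gram matrices, each new reflection
  fixes the images of the vectors treated before.
\<close>

lemma unitary_extension_finite:
  fixes p :: "complex ^ 'n \<Rightarrow> complex ^ 'n"
  assumes "finite B" and "\<And>a b. a \<in> B \<Longrightarrow> b \<in> B \<Longrightarrow> hip (p a) (p b) = hip a b"
  shows "\<exists>V. unitary_matrix V \<and> (\<forall>a\<in>B. V *v a = p a)"
  using assms
proof (induction B rule: finite_induct)
  case empty
  show ?case by (rule exI[of _ "mat 1"]) (simp add: unitary_matrix_scalar)
next
  case (insert a B)
  have "\<exists>V. unitary_matrix V \<and> (\<forall>b\<in>B. V *v b = p b)"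
    by (rule insert.IH) (simp add: insert.prems)
  then obtain V where V: "unitary_matrix V" "\<forall>b\<in>B. V *v b = p b" by blast
  have "norm (V *v a) = norm (p a)"
    using insert.prems[of a a] by (intro norm_eq_if_hip_eq) (simp only: hip_unitary[OF V(1)] insertI1)
  then obtain W where W: "unitary_matrix W" "W *v (V *v a) = p a"
    "\<forall>b. hip (V *v a) b = hip (p a) b \<longrightarrow> W *v b = b"
    using complex_reflection_exists by blast
  have "W *v (V *v b) = p b" if "b \<in> B" for b
  proof -
    have "hip (V *v a) (p b) = hip (p a) (p b)"
      using insert.prems[of a b] V that hip_unitary[OF V(1), of a b] by simp
    then show ?thesis using W(3)[rule_format, of "p b"] V(2) that by simp
  qed
  then have "\<forall>b\<in>insert a B. (W ** V) *v b = p b"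
    using W(2) by (simp add: matrix_vector_mul_assoc[symmetric])
  then show ?case using unitary_matrix_mult[OF W(1) V(1)] by blast
qed

text \<open>
  Finite-dimensional form of the principle that equal Gram kernels differ by a unitary map. A
  unitary matrix that is right on a basis chosen among the values of \<open>g\<close> is right on
  all of them, because the Gram kernel determines the distance from \<open>h x\<close> to \<open>V
  *v g x\<close>.
\<close>

proposition unitary_extension:
  fixes g h :: "'a \<Rightarrow> complex ^ 'n"
  assumes gram: "\<And>x y. x \<in> S \<Longrightarrow> y \<in> S \<Longrightarrow> hip (h x) (h y) = hip (g x) (g y)"
  shows "\<exists>V. unitary_matrix V \<and> (\<forall>x\<in>S. h x = V *v g x)"
proof -
  obtain B where B: "B \<subseteq> g ` S" "vec.independent B" "g ` S \<subseteq> vec.span B"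
    using vec.basis_exists[of "g ` S"] by metis
  have fin: "finite B" by (rule vec.finiteI_independent[OF B(2)])
  \<comment> \<open>Any preimages will do: \<open>h\<close> takes the same value at all of them, as the Gram kernel shows.\<close>
  define r where "r = (\<lambda>b. SOME x. x \<in> S \<and> g x = b)"
  have r: "r b \<in> S" "g (r b) = b" if "b \<in> B" for b
    using someI_ex[of "\<lambda>x. x \<in> S \<and> g x = b"] that B(1) by (auto simp: r_def)
  have "\<exists>V. unitary_matrix V \<and> (\<forall>b\<in>B. V *v b = h (r b))"
    by (rule unitary_extension_finite[OF fin]) (simp add: gram r)
  then obtain V where V: "unitary_matrix V" "\<And>b. b \<in> B \<Longrightarrow> V *v b = h (r b)" by blast
  have "h x = V *v g x" if x: "x \<in> S" for x
  proof -
    have "g x \<in> vec.span B" using B(3) x by auto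
    then obtain u where u: "g x = (\<Sum>b\<in>B. u b *s b)"
      unfolding vec.span_finite[OF fin] by auto
    have Vg: "V *v g x = (\<Sum>b\<in>B. u b *s h (r b))"
      unfolding u by (simp add: vec.sum vec.scale V(2))
    have hipb: "hip (h x) (h (r b)) = hip (g x) b" if "b \<in> B" for b
      using gram[OF x r(1)[OF that]] r(2)[OF that] by simp
    have "hip (h x) (V *v g x) = hip (g x) (g x)"
      unfolding Vg using arg_cong[OF u, of "hip (g x)"] by (simp add: hip_sum_right hipb)
    moreover have "hip (V *v g x) (h x) = hip (g x) (g x)"
      using calculation cnj_hip by metis
    moreover have "hip (V *v g x) (V *v g x) = hip (g x) (g x)" by (rule hip_unitary[OF V(1)])
    moreover have "hip (h x) (h x) = hip (g x) (g x)" by (rule gram[OF x x])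
    ultimately have "hip (h x - V *v g x) (h x - V *v g x) = 0" by simp
    then show ?thesis by (simp only: hip_self_eq_0 right_minus_eq)
  qed
  with V(1) show ?thesis by blast
qed

lemma card_orthogonal_le:
  fixes w :: "'a \<Rightarrow> complex ^ 'n"
  assumes orth: "\<And>a b. a \<in> I \<Longrightarrow> b \<in> I \<Longrightarrow> a \<noteq> b \<Longrightarrow> hip (w a) (w b) = 0"
    and nz: "\<And>a. a \<in> I \<Longrightarrow> w a \<noteq> 0"
  shows "finite I" "card I \<le> CARD('n)"
proof -
  have inj: "inj_on w I"
  proof (rule inj_onI, rule ccontr)
    fix a b assume ab: "a \<in> I" "b \<in> I" "w a = w b" "a \<noteq> b"
    then show False using orth[of a b] nz[of a] by simp
  qed
  have "vec.independent (w ` I)"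
    unfolding vec.dependent_explicit
  proof (intro notI, elim exE conjE bexE)
    fix T u v assume T: "finite T" "T \<subseteq> w ` I" "(\<Sum>v\<in>T. u v *s v) = 0" and v: "v \<in> T" "u v \<noteq> 0"
    have "0 = hip (\<Sum>x\<in>T. u x *s x) v" using T(3) by simp
    also have "\<dots> = (\<Sum>x\<in>T. if x = v then u v * hip v v else 0)"
      unfolding hip_sum_left
    proof (rule sum.cong[OF refl])
      fix x assume "x \<in> T"
      then obtain a b where "a \<in> I" "x = w a" "b \<in> I" "v = w b" using T(2) v(1) by blast
      then show "hip (u x *s x) v = (if x = v then u v * hip v v else 0)"
        using orth[of a b] by (cases "a = b") auto
    qed
    also have "\<dots> = u v * hip v v" using T(1) v(1) by simp
    finally have "v = 0" using v(2) by simp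
    then show False using v(1) T(2) nz by auto
  qed
  then have "finite (w ` I)" "card (w ` I) \<le> CARD('n)"
    using vec.finiteI_independent vec.independent_card_le_dim[of "w ` I" UNIV]
    by (auto simp: vec.dim_UNIV card_cart_basis)
  then show "finite I" "card I \<le> CARD('n)"
    using inj by (auto simp: card_image dest: finite_imageD)
qed

section \<open>The multinomial expansion of the tensor power kernel\<close>

text \<open>
  The exponents of the monomials in the variables indexed by \<open>S\<close>, made total
  functions with the value \<open>0\<close> elsewhere so that each exponent occurs once.
\<close>

definition multi_indices :: "'a set \<Rightarrow> nat \<Rightarrow> ('a \<Rightarrow> nat) set" where
  "multi_indices S m = {\<alpha>. (\<forall>i. i \<notin> S \<longrightarrow> \<alpha> i = 0) \<and> sum \<alpha> S = m}"

lemma finite_multi_indices: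
  assumes "finite S" shows "finite (multi_indices S m)"
proof (rule finite_subset)
  show "multi_indices S m \<subseteq> {f. \<forall>x. (x \<in> S \<longrightarrow> f x \<in> {..m}) \<and> (x \<notin> S \<longrightarrow> f x = 0)}"
    using assms by (auto simp: multi_indices_def intro: member_le_sum)
  show "finite {f. \<forall>x. (x \<in> S \<longrightarrow> f x \<in> {..m}) \<and> (x \<notin> S \<longrightarrow> f x = (0::nat))}"
    by (rule finite_set_of_finite_funs) (use assms in auto)
qed

lemma divided_power_add:
  fixes x y :: "'b :: field_char_0"
  shows "(x + y) ^ m / fact m = (\<Sum>k\<le>m. x ^ k / fact k * (y ^ (m - k) / fact (m - k)))"
  unfolding binomial_ring sum_divide_distrib
  by (rule sum.cong) (auto simp: binomial_fact)

lemma multinomial: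
  fixes x :: "'a \<Rightarrow> 'b :: field_char_0"
  assumes "finite S"
  shows "(\<Sum>i\<in>S. x i) ^ m / fact m = (\<Sum>\<alpha>\<in>multi_indices S m. \<Prod>i\<in>S. x i ^ \<alpha> i / fact (\<alpha> i))"
  using assms
proof (induction S arbitrary: m rule: finite_induct)
  case empty
  have "multi_indices ({} :: 'a set) m = (if m = 0 then {\<lambda>_. 0} else {})" for m
    by (auto simp: multi_indices_def)
  then show ?case by simp
next
  case (insert a S)
  \<comment> \<open>Split off the exponent \<open>k\<close> of the new variable.\<close>
  let ?P = "\<lambda>S \<alpha>. \<Prod>i\<in>S. x i ^ \<alpha> i / fact (\<alpha> i)"
  have "(\<Sum>i\<in>insert a S. x i) ^ m / fact m =
      (\<Sum>k\<le>m. x a ^ k / fact k * (\<Sum>\<beta>\<in>multi_indices S (m - k). ?P S \<beta>))"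
    using insert.hyps by (simp add: divided_power_add insert.IH)
  also have "\<dots> = (\<Sum>(k, \<beta>)\<in>Sigma {..m} (\<lambda>k. multi_indices S (m - k)). x a ^ k / fact k * ?P S \<beta>)"
    using insert.hyps by (simp add: sum_distrib_left sum.Sigma finite_multi_indices)
  also have "\<dots> = (\<Sum>\<alpha>\<in>multi_indices (insert a S) m. ?P (insert a S) \<alpha>)"
  proof (rule sum.reindex_bij_witness[where i = "\<lambda>\<alpha>. (\<alpha> a, \<alpha>(a := 0))" and j = "\<lambda>(k, \<beta>). \<beta>(a := k)"])
    fix p assume "p \<in> Sigma {..m} (\<lambda>k. multi_indices S (m - k))"
    then obtain k \<beta> where p: "p = (k, \<beta>)" and k: "k \<le> m" and \<beta>: "\<beta> \<in> multi_indices S (m - k)" by auto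
    have ba: "\<beta> a = 0" using \<beta> insert.hyps by (simp add: multi_indices_def)
    have S: "sum (\<beta>(a := k)) S = sum \<beta> S" "?P S (\<beta>(a := k)) = ?P S \<beta>"
      using insert.hyps by (auto intro!: sum.cong prod.cong)
    show "((case p of (k, \<beta>) \<Rightarrow> \<beta>(a := k)) a, (case p of (k, \<beta>) \<Rightarrow> \<beta>(a := k))(a := 0)) = p"
      using ba by (auto simp: p)
    show "(case p of (k, \<beta>) \<Rightarrow> \<beta>(a := k)) \<in> multi_indices (insert a S) m"
      using \<beta> k insert.hyps S by (auto simp: p multi_indices_def simp del: fun_upd_apply) auto
    show "?P (insert a S) (case p of (k, \<beta>) \<Rightarrow> \<beta>(a := k)) = (case p of (k, \<beta>) \<Rightarrow> x a ^ k / fact k * ?P S \<beta>)"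
      unfolding p prod.case prod.insert[OF insert.hyps] S(2) by simp
  next
    fix \<alpha> assume \<alpha>: "\<alpha> \<in> multi_indices (insert a S) m"
    have S: "sum (\<alpha>(a := 0)) S = sum \<alpha> S" using insert.hyps by (auto intro!: sum.cong)
    show "(case (\<alpha> a, \<alpha>(a := 0)) of (k, \<beta>) \<Rightarrow> \<beta>(a := k)) = \<alpha>" by auto
    show "(\<alpha> a, \<alpha>(a := 0)) \<in> Sigma {..m} (\<lambda>k. multi_indices S (m - k))"
      using \<alpha> insert.hyps S by (auto simp: multi_indices_def)
  qed
  finally show ?case .
qed

text \<open>
  The normalising constants of the tensor power are those of the multinomial theorem.
\<close>

lemma tensor_power_kernel:
  fixes z w :: "complex ^ 'n"
  shows "(\<Sum>\<alpha> | (\<Sum>i\<in>UNIV. \<alpha> i) = m. tensor_power_component \<alpha> z * cnj (tensor_power_component \<alpha> w)) = hip z w ^ m"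
proof -
  have "tensor_power_component \<alpha> z * cnj (tensor_power_component \<alpha> w) =
     fact m * (\<Prod>i\<in>UNIV. (z $ i * cnj (w $ i)) ^ \<alpha> i / fact (\<alpha> i))"
    if "(\<Sum>i\<in>UNIV. \<alpha> i) = m" for \<alpha> :: "'n \<Rightarrow> nat"
  proof -
    let ?c = "fact m / (\<Prod>i\<in>UNIV. fact (\<alpha> i)) :: real"
    have "complex_of_real (sqrt ?c) * of_real (sqrt ?c) = of_real ?c"
      unfolding of_real_mult[symmetric] by (subst real_sqrt_mult_self) (simp add: prod_nonneg)
    then have "tensor_power_component \<alpha> z * cnj (tensor_power_component \<alpha> w) =
       of_real ?c * (monomial \<alpha> z * cnj (monomial \<alpha> w))"
      unfolding tensor_power_component_def that by (simp add: mult_ac)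
    also have "monomial \<alpha> z * cnj (monomial \<alpha> w) = (\<Prod>i\<in>UNIV. (z $ i * cnj (w $ i)) ^ \<alpha> i)"
      by (simp add: monomial_def prod.distrib power_mult_distrib)
    finally show ?thesis by (simp add: prod_dividef)
  qed
  then have "(\<Sum>\<alpha> | (\<Sum>i\<in>UNIV. \<alpha> i) = m. tensor_power_component \<alpha> z * cnj (tensor_power_component \<alpha> w)) =
      fact m * (\<Sum>\<alpha>\<in>multi_indices UNIV m. \<Prod>i\<in>UNIV. (z $ i * cnj (w $ i)) ^ \<alpha> i / fact (\<alpha> i))"
    by (simp add: multi_indices_def sum_distrib_left)
  also have "\<dots> = hip z w ^ m"
    by (subst multinomial[symmetric]) (simp_all add: hip_def)
  finally show ?thesis .
qed

section \<open>Counting the monomials of a kernel\<close>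

lemma sum_roots_of_unity_orthogonal:
  assumes "a < L" "b < L"
  defines "\<omega> \<equiv> \<lambda>k::nat. cis (2 * pi * real k / real L)"
  shows "(\<Sum>k<L. cnj (\<omega> k) ^ a * \<omega> k ^ b) = (if a = b then of_nat L else 0)"
proof -
  have L: "L > 0" using assms by simp
  define c where "c = cnj (\<omega> a) * \<omega> b"
  have \<omega>: "\<omega> k ^ j = \<omega> j ^ k" for j k
    by (simp add: \<omega>_def Complex.DeMoivre mult_ac)
  have "cnj (\<omega> k) ^ a * \<omega> k ^ b = c ^ k" for k
    by (simp add: c_def power_mult_distrib \<omega> flip: complex_cnj_power)
  then have "(\<Sum>k<L. cnj (\<omega> k) ^ a * \<omega> k ^ b) = (\<Sum>k<L. c ^ k)" by simp
  also have "\<dots> = (if a = b then of_nat L else 0)"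
  proof (cases "a = b")
    case True
    have "c = 1" using True complex_norm_square[of "\<omega> a"] by (simp add: c_def \<omega>_def mult.commute)
    then show ?thesis using True by simp
  next
    case False
    have "inj_on \<omega> {..<L}" using Complex.bij_betw_roots_unity[OF L] by (simp add: bij_betw_def \<omega>_def)
    then have "\<omega> a \<noteq> \<omega> b" using False assms(1,2) by (auto dest: inj_onD)
    moreover have "\<omega> a * c = \<omega> b"
      using complex_norm_square[of "\<omega> a"] by (simp add: c_def \<omega>_def flip: mult.assoc)
    ultimately have "c \<noteq> 1" by auto
    moreover have "\<omega> k ^ L = 1" for k
      using L by (simp add: \<omega>_def Complex.DeMoivre cis_multiple_2pi)
    then have "c ^ L = 1" by (simp add: c_def power_mult_distrib flip: complex_cnj_power)
    ultimately show ?thesis using False by (simp add: geometric_sum)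
  qed
  finally show ?thesis .
qed

text \<open>
  Discrete Fourier analysis on a torus of small radius: summing over a grid of \<open>L\<close>-th
  roots of unity in each coordinate, with \<open>L\<close> larger than all exponents in
  \<open>I\<close>, isolates a single coefficient of a combination of the monomials in
  \<open>I\<close>.
\<close>

lemma monomial_coefficient_extraction:
  fixes I :: "('n::finite \<Rightarrow> nat) set"
  assumes "finite I"
  shows "\<exists>(K :: ('n \<Rightarrow> nat) set) (e :: ('n \<Rightarrow> nat) \<Rightarrow> ('n \<Rightarrow> nat) \<Rightarrow> complex)
      (x :: ('n \<Rightarrow> nat) \<Rightarrow> complex ^ 'n) D.
    (\<forall>k. norm (x k) < 1) \<and> (\<forall>\<alpha>. D \<alpha> \<noteq> 0) \<and>
    (\<forall>\<alpha>\<in>I. \<forall>\<beta>\<in>I. (\<Sum>k\<in>K. e \<alpha> k * monomial \<beta> (x k)) = (if \<alpha> = \<beta> then D \<alpha> else 0))"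
proof -
  \<comment> \<open>Any bound above all the exponents in \<open>I\<close>.\<close>
  define L where "L = Suc (\<Sum>\<alpha>\<in>I. \<Sum>i\<in>UNIV. \<alpha> i)"
  \<comment> \<open>Small enough for a vector with entries of modulus \<open>r\<close> to lie in the ball.\<close>
  define r where "r = 1 / real (Suc CARD('n))"
  have r0: "r \<ge> 0" by (simp add: r_def)
  define \<omega> where "\<omega> = (\<lambda>k::nat. cis (2 * pi * real k / real L))"
  define K where "K = (PiE UNIV (\<lambda>_. {..<L}) :: ('n \<Rightarrow> nat) set)"
  define x :: "('n \<Rightarrow> nat) \<Rightarrow> complex ^ 'n" where "x = (\<lambda>k. \<chi> i. of_real r * \<omega> (k i))"
  define e :: "('n \<Rightarrow> nat) \<Rightarrow> ('n \<Rightarrow> nat) \<Rightarrow> complex" where "e = (\<lambda>\<alpha> k. \<Prod>i\<in>UNIV. cnj (\<omega> (k i)) ^ \<alpha> i)"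
  define D :: "('n \<Rightarrow> nat) \<Rightarrow> complex" where "D = (\<lambda>\<alpha>. \<Prod>i\<in>UNIV. of_real r ^ \<alpha> i * of_nat L)"
  have L: "\<alpha> i < L" if "\<alpha> \<in> I" for \<alpha> i
  proof -
    have "\<alpha> i \<le> (\<Sum>i\<in>UNIV. \<alpha> i)" by (rule member_le_sum) auto
    also have "\<dots> \<le> (\<Sum>\<alpha>\<in>I. \<Sum>i\<in>UNIV. \<alpha> i)"
      by (rule member_le_sum[of _ _ "\<lambda>\<alpha>. \<Sum>i\<in>UNIV. \<alpha> i"]) (use that assms in auto)
    finally show ?thesis by (simp add: L_def)
  qed
  show ?thesis
  proof (intro exI[of _ K] exI[of _ e] exI[of _ x] exI[of _ D] conjI allI ballI)
    show "norm (x k) < 1" for k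
    proof -
      have "norm (x k) \<le> (\<Sum>i\<in>UNIV. cmod (x k $ i))"
        unfolding norm_vec_def by (rule L2_set_le_sum) auto
      also have "\<dots> = (\<Sum>i\<in>(UNIV :: 'n set). r)"
        using r0 by (intro sum.cong) (simp_all add: x_def \<omega>_def norm_mult)
      also have "\<dots> = real CARD('n) * r" by simp
      also have "\<dots> < 1" by (simp add: r_def field_simps)
      finally show ?thesis .
    qed
    show "D \<alpha> \<noteq> 0" for \<alpha> by (simp add: D_def r_def L_def del: of_nat_Suc)
    fix \<alpha> \<beta> assume \<alpha>: "\<alpha> \<in> I" and \<beta>: "\<beta> \<in> I"
    have "(\<Sum>k\<in>K. e \<alpha> k * monomial \<beta> (x k)) =
        (\<Sum>k\<in>K. \<Prod>i\<in>UNIV. of_real r ^ \<beta> i * (cnj (\<omega> (k i)) ^ \<alpha> i * \<omega> (k i) ^ \<beta> i))"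
      by (simp add: e_def monomial_def x_def power_mult_distrib prod.distrib[symmetric] mult_ac)
    also have "\<dots> = (\<Prod>i\<in>UNIV. \<Sum>j<L. of_real r ^ \<beta> i * (cnj (\<omega> j) ^ \<alpha> i * \<omega> j ^ \<beta> i))"
      unfolding K_def by (rule prod_sum_PiE[symmetric]) auto
    also have "\<dots> = (\<Prod>i\<in>UNIV. of_real r ^ \<beta> i * (if \<alpha> i = \<beta> i then of_nat L else 0))"
      unfolding sum_distrib_left[symmetric] \<omega>_def
      by (simp only: sum_roots_of_unity_orthogonal[OF L[OF \<alpha>] L[OF \<beta>]])
    also have "\<dots> = (if \<alpha> = \<beta> then D \<alpha> else 0)"
    proof (cases "\<alpha> = \<beta>")
      case False
      then obtain i where "\<alpha> i \<noteq> \<beta> i" by auto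
      then show ?thesis using False by (auto intro!: prod_zero)
    qed (simp add: D_def)
    finally show "(\<Sum>k\<in>K. e \<alpha> k * monomial \<beta> (x k)) = (if \<alpha> = \<beta> then D \<alpha> else 0)" .
  qed
qed

text \<open>
  The coefficient functionals, applied to \<open>h\<close>, give one vector of the target for
  every monomial. The kernel shows that these vectors are orthogonal and nonzero.
\<close>

proposition card_monomials_le_dimension:
  fixes h :: "complex ^ 'n \<Rightarrow> complex ^ 'm"
  assumes fin: "finite I" and C: "\<And>\<alpha>. \<alpha> \<in> I \<Longrightarrow> C \<alpha> \<noteq> 0"
    and kernel: "\<And>z w. norm z < 1 \<Longrightarrow> norm w < 1 \<Longrightarrow>
      hip (h z) (h w) = (\<Sum>\<alpha>\<in>I. (C \<alpha> * monomial \<alpha> z) * cnj (C \<alpha> * monomial \<alpha> w))"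
  shows "card I \<le> CARD('m)"
proof -
  obtain K :: "('n \<Rightarrow> nat) set" and e x D where ex:
    "(\<forall>k. norm (x k :: complex ^ 'n) < 1) \<and> (\<forall>\<alpha>. D \<alpha> \<noteq> 0) \<and>
     (\<forall>\<alpha>\<in>I. \<forall>\<beta>\<in>I. (\<Sum>k\<in>K. e \<alpha> k * monomial \<beta> (x k)) = (if \<alpha> = \<beta> then D \<alpha> else 0))"
    using monomial_coefficient_extraction[OF fin] by (elim exE) (rule that)
  from ex have x: "norm (x k) < 1" for k by blast
  from ex have D: "D \<alpha> \<noteq> 0" for \<alpha> by blast
  from ex have ex: "(\<Sum>k\<in>K. e \<alpha> k * monomial \<beta> (x k)) = (if \<alpha> = \<beta> then D \<alpha> else 0)"
    if "\<alpha> \<in> I" "\<beta> \<in> I" for \<alpha> \<beta> using that by blast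
  \<comment> \<open>Up to a factor, \<open>w \<alpha>\<close> is the coefficient of the monomial \<open>\<alpha>\<close> in \<open>h\<close>.\<close>
  define w where "w = (\<lambda>\<alpha>. \<Sum>k\<in>K. e \<alpha> k *s h (x k))"
  have hip_w: "hip (w \<alpha>) (w \<beta>) = (if \<alpha> = \<beta> then C \<alpha> * D \<alpha> * cnj (C \<alpha> * D \<alpha>) else 0)"
    if \<alpha>: "\<alpha> \<in> I" and \<beta>: "\<beta> \<in> I" for \<alpha> \<beta>
  proof -
    have "hip (w \<alpha>) (w \<beta>) = (\<Sum>k\<in>K. \<Sum>l\<in>K. \<Sum>\<gamma>\<in>I.
        (C \<gamma> * cnj (C \<gamma>)) * ((e \<alpha> k * monomial \<gamma> (x k)) * cnj (e \<beta> l * monomial \<gamma> (x l))))"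
      unfolding w_def hip_sum_left hip_sum_right
      by (subst sum.swap) (simp add: kernel x sum_distrib_left mult_ac)
    also have "\<dots> = (\<Sum>\<gamma>\<in>I. \<Sum>k\<in>K. \<Sum>l\<in>K.
        (C \<gamma> * cnj (C \<gamma>)) * ((e \<alpha> k * monomial \<gamma> (x k)) * cnj (e \<beta> l * monomial \<gamma> (x l))))"
      by (subst (2) sum.swap, subst sum.swap) (rule refl)
    also have "\<dots> = (\<Sum>\<gamma>\<in>I. (C \<gamma> * cnj (C \<gamma>)) *
        ((\<Sum>k\<in>K. e \<alpha> k * monomial \<gamma> (x k)) * cnj (\<Sum>l\<in>K. e \<beta> l * monomial \<gamma> (x l))))"
      unfolding cnj_sum sum_product by (simp add: sum_distrib_left)
    also have "\<dots> = (\<Sum>\<gamma>\<in>I. if \<gamma> = \<alpha> then (if \<alpha> = \<beta> then C \<alpha> * D \<alpha> * cnj (C \<alpha> * D \<alpha>) else 0) else 0)"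
      by (rule sum.cong) (auto simp: ex \<alpha> \<beta>)
    finally show ?thesis using \<alpha> fin by simp
  qed
  show ?thesis
  proof (rule card_orthogonal_le)
    show "hip (w \<alpha>) (w \<beta>) = 0" if "\<alpha> \<in> I" "\<beta> \<in> I" "\<alpha> \<noteq> \<beta>" for \<alpha> \<beta> using hip_w that by simp
    show "w \<alpha> \<noteq> 0" if "\<alpha> \<in> I" for \<alpha>
    proof -
      have "hip (w \<alpha>) (w \<alpha>) \<noteq> 0" using hip_w[OF that that] C[OF that] D[of \<alpha>] by simp
      then show ?thesis by auto
    qed
  qed
qed

section \<open>Unitarily invariant kernels\<close>

lemma power_series_coefficients_unique:
  fixes p q :: "nat \<Rightarrow> complex"
  assumes p: "\<And>s. cmod s < 1 \<Longrightarrow> (\<lambda>m. p m * s ^ m) sums f s"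
    and q: "\<And>s. cmod s < 1 \<Longrightarrow> (\<lambda>m. q m * s ^ m) sums f s"
  shows "p m = q m"
proof -
  define d where "d = (\<lambda>m. p m - q m)"
  have d: "(\<lambda>m. d m * s ^ m) sums 0" if "cmod s < 1" for s
    using sums_diff[OF p[OF that] q[OF that]] by (simp add: d_def left_diff_distrib)
  have "d m = 0"
  proof (rule ccontr)
    assume ne: "d m \<noteq> 0"
    have "d 0 = 0" using d[of 0] by simp
    then have "m > 0" using ne by (cases m) auto
    show False
    proof (rule powser_0_nonzero[where r = 1 and \<xi> = 0 and a = d and f = "\<lambda>_. 0" and m = m])
      fix s :: real
      assume "0 < s" "\<And>z. z \<in> cball (0::complex) s - {0} \<Longrightarrow> (0::complex) \<noteq> 0"
      from this(2)[of "of_real s"] this(1) show False by simp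
    qed (use d ne \<open>m > 0\<close> in simp_all)
  qed
  then show ?thesis by (simp add: d_def)
qed

definition unitarily_invariant_kernel :: "(complex ^ 'n \<Rightarrow> complex ^ 'm) \<Rightarrow> bool" where
  "unitarily_invariant_kernel h \<longleftrightarrow> (\<forall>U z w. unitary_matrix U \<longrightarrow> norm z < 1 \<longrightarrow> norm w < 1 \<longrightarrow>
     hip (h (U *v z)) (h (U *v w)) = hip (h z) (h w))"

text \<open>
  Two pairs of vectors with the same Gram matrix are related by a unitary matrix.
\<close>

lemma kernel_depends_on_hip:
  assumes h: "unitarily_invariant_kernel h" and x: "norm x < 1" and y: "norm y < 1"
    and eq: "hip x' x' = hip x x" "hip y' y' = hip y y" "hip x' y' = hip x y"
  shows "hip (h x') (h y') = hip (h x) (h y)"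
proof -
  have eq': "hip y' x' = hip y x" using eq(3) by (metis cnj_hip)
  have "\<exists>V. unitary_matrix V \<and> (\<forall>b\<in>UNIV. (if b then x' else y') = V *v (if b then x else y))"
    by (rule unitary_extension) (auto simp: eq eq')
  then obtain V where V: "unitary_matrix V"
    "\<And>b. (if b then x' else y') = V *v (if b then x else y)" by blast
  have "x' = V *v x" "y' = V *v y" using V(2)[of True] V(2)[of False] by simp_all
  then show ?thesis using h V(1) x y unfolding unitarily_invariant_kernel_def by simp
qed

text \<open>
  Write \<open>z = P + q\<close> with \<open>P\<close> a multiple of \<open>w\<close> and
  \<open>q\<close> orthogonal to \<open>w\<close>. The kernel at \<open>(P + l *s q, w)\<close> is
  holomorphic in \<open>l\<close>, and by invariance it is constant on the unit circle. The
  maximum principle makes it constant on the disc, so the values at \<open>l = 1\<close> and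
  \<open>l = 0\<close> agree.
\<close>

lemma kernel_projection:
  assumes h: "unitarily_invariant_kernel h" and hol: "holomorphic_map_on h (ball 0 1)"
    and z: "norm z < 1" and w: "norm w < 1" "w \<noteq> 0"
  shows "hip (h z) (h w) = hip (h ((hip z w / hip w w) *s w)) (h w)"
proof -
  define P where "P = (hip z w / hip w w) *s w"
  define q where "q = z - P"
  have qw: "hip q w = 0" using w(2) by (simp add: q_def P_def)
  then have wq: "hip w q = 0" by (metis cnj_hip complex_cnj_zero)
  have qP: "hip q P = 0" "hip P q = 0" by (simp_all add: P_def qw wq)
  have zqP: "z = 1 *s q + P" by (simp add: q_def)
  have hip_slice: "hip (l *s q + P) (l *s q + P) = of_real ((cmod l)\<^sup>2) * hip q q + hip P P" for l
    unfolding complex_norm_square by (simp add: qP mult_ac)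
  have le: "norm (l *s q + P) < 1" if l: "cmod l \<le> 1" for l
  proof -
    have norm_slice: "(norm (l *s q + P))\<^sup>2 = (cmod l)\<^sup>2 * (norm q)\<^sup>2 + (norm P)\<^sup>2" for l
    proof -
      have "complex_of_real ((norm (l *s q + P))\<^sup>2) = of_real ((cmod l)\<^sup>2 * (norm q)\<^sup>2 + (norm P)\<^sup>2)"
        using hip_slice[of l] unfolding hip_self of_real_add of_real_mult .
      then show ?thesis by (simp only: of_real_eq_iff)
    qed
    have "(cmod l)\<^sup>2 * (norm q)\<^sup>2 \<le> 1 * (norm q)\<^sup>2"
      using l by (intro mult_right_mono) (auto simp: power_le_one)
    then have "(norm (l *s q + P))\<^sup>2 \<le> (norm (1 *s q + P))\<^sup>2"
      unfolding norm_slice[of l] norm_slice[of 1] by simp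
    then have "norm (l *s q + P) \<le> norm z" unfolding zqP[symmetric] by (simp add: power2_le_iff_abs_le)
    then show ?thesis using z by simp
  qed
  define F where "F = (\<lambda>l. hip (h (l *s q + P)) (h w))"
  have hF: "F holomorphic_on cball 0 1"
    unfolding F_def by (rule slice_hip_holomorphic[OF hol]) (simp add: le)
  have circle: "F l = F 1" if l: "cmod l = 1" for l
    unfolding F_def
  proof (rule kernel_depends_on_hip[OF h])
    show "norm (1 *s q + P) < 1" "norm w < 1" using le[of 1] w by auto
    show "hip (l *s q + P) (l *s q + P) = hip (1 *s q + P) (1 *s q + P)"
      unfolding hip_slice using l by simp
    show "hip (l *s q + P) w = hip (1 *s q + P) w" by (simp add: qw)
  qed simp
  have "cmod (F 0 - F 1) \<le> 0"
  proof (rule maximum_modulus_frontier[where S = "cball 0 1" and f = "\<lambda>l. F l - F 1"])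
    show "(\<lambda>l. F l - F 1) holomorphic_on interior (cball 0 1)"
      using hF by (auto intro!: holomorphic_intros elim: holomorphic_on_subset)
    show "continuous_on (closure (cball 0 1)) (\<lambda>l. F l - F 1)"
      using holomorphic_on_imp_continuous_on[OF hF] by (auto intro!: continuous_intros)
    show "cmod (F l - F 1) \<le> 0" if "l \<in> frontier (cball 0 1)" for l
      using that circle[of l] by (simp add: frontier_cball)
  qed auto
  then have "F 1 = F 0" by simp
  then show ?thesis unfolding F_def zqP[symmetric] by (simp add: P_def)
qed

definition slice_coefficient :: "(complex ^ 'n \<Rightarrow> complex ^ 'm) \<Rightarrow> complex ^ 'n \<Rightarrow> nat \<Rightarrow> complex ^ 'm" where
  "slice_coefficient h e m = (\<chi> i. (deriv ^^ m) (\<lambda>s. h (s *s e) $ i) 0 / fact m)"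

lemma slice_power_series:
  assumes hol: "holomorphic_map_on h (ball 0 1)" and e: "norm e = 1" and s: "cmod s < 1"
  shows "(\<lambda>m. hip (slice_coefficient h e m) v * s ^ m) sums hip (h (s *s e)) v"
proof -
  have "(\<lambda>m. slice_coefficient h e m $ i * s ^ m) sums (h (s *s e) $ i)" for i
  proof -
    have "(\<lambda>s. h (s *s e + 0) $ i) holomorphic_on ball 0 1"
      by (rule slice_component_holomorphic[OF hol]) (use e in \<open>simp add: norm_csmult\<close>)
    then have "(\<lambda>s. h (s *s e) $ i) holomorphic_on ball 0 1" by simp
    from holomorphic_power_series[OF this, of s] s show ?thesis by (simp add: slice_coefficient_def)
  qed
  then have "(\<lambda>m. \<Sum>i\<in>UNIV. (slice_coefficient h e m $ i * s ^ m) * cnj (v $ i)) sums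
      (\<Sum>i\<in>UNIV. h (s *s e) $ i * cnj (v $ i))"
    by (intro sums_sum sums_mult2) auto
  then show ?thesis by (simp add: hip_def sum_distrib_left mult_ac)
qed

text \<open>
  Rotating the slice by a unimodular \<open>c\<close> leaves the kernel unchanged and multiplies
  the product of the coefficients of degrees \<open>l\<close> and \<open>m\<close> by \<open>c ^ l
  * cnj c ^ m\<close>. The chosen \<open>c\<close> makes this factor \<open>-1\<close>.
\<close>

lemma slice_coefficients_orthogonal:
  assumes h: "unitarily_invariant_kernel h" and hol: "holomorphic_map_on h (ball 0 1)"
    and e: "norm e = 1" and ne: "l \<noteq> m"
  shows "hip (slice_coefficient h e l) (slice_coefficient h e m) = 0"
proof -
  let ?A = "slice_coefficient h e"
  note series = slice_power_series[OF hol e]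
  define c where "c = cis (pi / (real l - real m))"
  have c: "cmod c = 1" by (simp add: c_def)
  have ee: "hip e e = 1" using e by (simp add: hip_self)
  have cc: "c * cnj c = 1" "cnj c * c = 1" using complex_norm_square[of c] c by (simp_all add: mult.commute)
  have rot: "hip (h ((c * s) *s e)) (h ((c * t) *s e)) = hip (h (s *s e)) (h (t *s e))"
    if "cmod s < 1" "cmod t < 1" for s t
  proof -
    show ?thesis
      by (intro kernel_depends_on_hip[OF h]) (use that e in \<open>simp_all add: norm_csmult ee cc\<close>)
  qed
  \<comment> \<open>Compare coefficients in the first variable, then in the second.\<close>
  have A1: "hip (?A m) (h ((c * t) *s e)) * c ^ m = hip (?A m) (h (t *s e))" if t: "cmod t < 1" for t m
  proof (rule power_series_coefficients_unique[where f = "\<lambda>s. hip (h (s *s e)) (h (t *s e))"])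
    fix s assume s: "cmod s < 1"
    have "cmod (c * s) < 1" using s c by (simp add: norm_mult)
    from series[OF this, of "h ((c * t) *s e)"]
    show "(\<lambda>m. hip (?A m) (h ((c * t) *s e)) * c ^ m * s ^ m) sums hip (h (s *s e)) (h (t *s e))"
      by (simp add: rot[OF s t] power_mult_distrib mult_ac)
    show "(\<lambda>m. hip (?A m) (h (t *s e)) * s ^ m) sums hip (h (s *s e)) (h (t *s e))"
      by (rule series[OF s])
  qed
  have A2: "hip (h ((c * t) *s e)) (?A m) * cnj c ^ m = hip (h (t *s e)) (?A m)" if t: "cmod t < 1" for t
    using arg_cong[OF A1[OF t, of m], of cnj] by (simp add: cnj_hip)
  have "hip (?A l) (?A m) * (c ^ l * cnj c ^ m) = hip (?A l) (?A m)"
  proof (rule power_series_coefficients_unique[where f = "\<lambda>t. hip (h (t *s e)) (?A m)" and m = l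
      and p = "\<lambda>l. hip (?A l) (?A m) * (c ^ l * cnj c ^ m)" and q = "\<lambda>l. hip (?A l) (?A m)"])
    fix t assume t: "cmod t < 1"
    have "cmod (c * t) < 1" using t c by (simp add: norm_mult)
    from sums_mult2[OF series[OF this, of "?A m"], of "cnj c ^ m"]
    show "(\<lambda>l. hip (?A l) (?A m) * (c ^ l * cnj c ^ m) * t ^ l) sums hip (h (t *s e)) (?A m)"
      unfolding A2[OF t] by (simp add: power_mult_distrib mult_ac)
    show "(\<lambda>l. hip (?A l) (?A m) * t ^ l) sums hip (h (t *s e)) (?A m)" by (rule series[OF t])
  qed
  moreover have "c ^ l * cnj c ^ m = -1"
  proof -
    have "c ^ l * cnj c ^ m = cis ((real l - real m) * (pi / (real l - real m)))"
      by (simp add: c_def Complex.DeMoivre cis_cnj cis_mult left_diff_distrib diff_divide_distrib)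
    also have "(real l - real m) * (pi / (real l - real m)) = pi" using ne by simp
    finally show ?thesis by simp
  qed
  ultimately show ?thesis by simp
qed

text \<open>
  Orthogonality removes the mixed terms of the double power series. It also leaves only finitely
  many nonzero coefficients, as they lie in a finite-dimensional space.
\<close>

lemma kernel_on_slice:
  fixes h :: "complex ^ 'n \<Rightarrow> complex ^ 'm"
  assumes h: "unitarily_invariant_kernel h" and hol: "holomorphic_map_on h (ball 0 1)"
    and e: "norm e = 1"
  defines "A \<equiv> slice_coefficient h e"
  assumes s: "cmod s < 1" and t: "cmod t < 1"
  shows "finite {m. A m \<noteq> 0}"
    and "hip (h (s *s e)) (h (t *s e)) = (\<Sum>m | A m \<noteq> 0. of_real ((norm (A m))\<^sup>2) * (s * cnj t) ^ m)"
proof -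
  note series = slice_power_series[OF hol e, folded A_def]
  note orth = slice_coefficients_orthogonal[OF h hol e, folded A_def]
  show fin: "finite {m. A m \<noteq> 0}" by (rule card_orthogonal_le(1)[of _ A]) (auto simp: orth)
  have "hip (h (t *s e)) (A m) = hip (A m) (A m) * t ^ m" for m
  proof -
    have "(\<lambda>l. hip (A l) (A m) * t ^ l) sums (hip (A m) (A m) * t ^ m)"
      using sums_single[of m "\<lambda>l. hip (A l) (A m) * t ^ l"]
      by (rule sums_cong[THEN iffD1, rotated]) (simp add: orth)
    with series[OF t, of "A m"] show ?thesis by (rule sums_unique2)
  qed
  then have At: "hip (A m) (h (t *s e)) = of_real ((norm (A m))\<^sup>2) * cnj t ^ m" for m
    by (metis cnj_hip complex_cnj_mult complex_cnj_power hip_self)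
  have "(\<lambda>m. hip (A m) (h (t *s e)) * s ^ m) sums (\<Sum>m | A m \<noteq> 0. hip (A m) (h (t *s e)) * s ^ m)"
    by (rule sums_finite[OF fin]) auto
  with series[OF s, of "h (t *s e)"]
  have "hip (h (s *s e)) (h (t *s e)) = (\<Sum>m | A m \<noteq> 0. hip (A m) (h (t *s e)) * s ^ m)"
    by (rule sums_unique2)
  then show "hip (h (s *s e)) (h (t *s e)) = (\<Sum>m | A m \<noteq> 0. of_real ((norm (A m))\<^sup>2) * (s * cnj t) ^ m)"
    by (simp add: At power_mult_distrib mult_ac)
qed

text \<open>
  Projecting \<open>z\<close> to the line through \<open>w\<close> and rotating that line to the
  line through \<open>e\<close> reduces the kernel to a single slice.
\<close>

proposition unitarily_invariant_kernel_polynomial: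
  fixes h :: "complex ^ 'n \<Rightarrow> complex ^ 'm"
  assumes h: "unitarily_invariant_kernel h" and hol: "holomorphic_map_on h (ball 0 1)"
  shows "\<exists>M c. finite M \<and> (\<forall>m\<in>M. (c m :: real) > 0) \<and>
    (\<forall>z w. norm z < 1 \<longrightarrow> norm w < 1 \<longrightarrow> hip (h z) (h w) = (\<Sum>m\<in>M. of_real (c m) * hip z w ^ m))"
proof -
  \<comment> \<open>An arbitrary unit vector.\<close>
  define e :: "complex ^ 'n" where "e = axis undefined 1"
  have e: "norm e = 1" by (simp add: e_def)
  then have ee: "hip e e = 1" by (simp add: hip_self)
  define A where "A = slice_coefficient h e"
  define M where "M = {m. A m \<noteq> 0}"
  define c where "c = (\<lambda>m. (norm (A m))\<^sup>2)"
  note slice = kernel_on_slice[OF h hol e, folded A_def, folded M_def]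
  have main: "hip (h z) (h w) = (\<Sum>m\<in>M. of_real (c m) * hip z w ^ m)"
    if z: "norm z < 1" and w: "norm w < 1" "w \<noteq> 0" for z w
  proof -
    \<comment> \<open>The slice parameters for which \<open>s *s e\<close> and \<open>t *s e\<close> have the Gram matrix of the projection of \<open>z\<close> and \<open>w\<close>.\<close>
    define s where "s = hip z w / of_real (norm w)"
    define t where "t = complex_of_real (norm w)"
    have st: "s * cnj t = hip z w" using w(2) by (simp add: s_def t_def)
    have "cmod (hip z w) \<le> norm z * norm w" by (rule hip_Cauchy_Schwarz)
    then have "cmod s \<le> norm z" using w(2) by (simp add: s_def norm_divide divide_le_eq)
    then have s1: "cmod s < 1" using z by simp
    have t1: "cmod t < 1" using w(1) by (simp add: t_def)
    define P where "P = (hip z w / hip w w) *s w"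
    have P: "P = (s / t) *s w" using w(2) by (simp add: P_def s_def t_def hip_self power2_eq_square)
    have "hip (h z) (h w) = hip (h P) (h w)" unfolding P_def by (rule kernel_projection[OF h hol z w])
    also have "\<dots> = hip (h (s *s e)) (h (t *s e))"
    proof (rule kernel_depends_on_hip[OF h])
      show "norm (s *s e) < 1" "norm (t *s e) < 1" using s1 t1 e by (simp_all add: norm_csmult)
      have ww: "hip w w = t * t" by (simp add: hip_self t_def power2_eq_square)
      have tt: "cnj t = t" "t \<noteq> 0" using w(2) by (simp_all add: t_def)
      show "hip P P = hip (s *s e) (s *s e)" "hip w w = hip (t *s e) (t *s e)"
        "hip P w = hip (s *s e) (t *s e)"
        using tt by (simp_all add: P ee ww)
    qed
    also have "\<dots> = (\<Sum>m\<in>M. of_real (c m) * (s * cnj t) ^ m)"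
      unfolding c_def by (rule slice(2)[OF s1 t1])
    finally show ?thesis by (simp only: st)
  qed
  have main0: "hip (h z) (h 0) = (\<Sum>m\<in>M. of_real (c m) * hip z 0 ^ m)" if z: "norm z < 1" for z
  proof (cases "z = 0")
    case True
    then show ?thesis using slice(2)[of 0 0] by (simp add: c_def)
  next
    case False
    have "hip (h z) (h 0) = cnj (hip (h 0) (h z))" by (simp only: cnj_hip)
    also have "\<dots> = (\<Sum>m\<in>M. of_real (c m) * hip z 0 ^ m)"
      unfolding main[of 0 z, OF _ z False, simplified] by simp
    finally show ?thesis .
  qed
  show ?thesis
  proof (intro exI[of _ M] exI[of _ c] conjI ballI allI impI)
    show "finite M" using slice(1)[of 0 0] by simp
    show "c m > 0" if "m \<in> M" for m using that by (simp add: c_def M_def)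
    show "hip (h z) (h w) = (\<Sum>m\<in>M. of_real (c m) * hip z w ^ m)" if "norm z < 1" "norm w < 1" for z w
      using main[OF that] main0[OF that(1)] by (cases "w = 0") auto
  qed
qed

section \<open>Weighted orthogonal sums of tensor powers\<close>

lemma finite_exponents: "finite {\<alpha> :: 'n::finite \<Rightarrow> nat. (\<Sum>i\<in>UNIV. \<alpha> i) = d}"
  using finite_multi_indices[of "UNIV :: 'n set" d] by (simp add: multi_indices_def)

lemma weighted_orthogonal_sum_kernel:
  assumes g: "is_weighted_orthogonal_sum k m lam g" and z: "norm z < 1" and w: "norm w < 1"
  shows "hip (g z) (g w) = (\<Sum>j=1..k. of_real ((cmod (lam j))\<^sup>2) * hip z w ^ m j)"
proof -
  let ?I = "orthogonal_sum_index k m :: (nat \<times> ('a \<Rightarrow> nat)) set"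
  obtain e where inj: "inj_on e ?I" and
    e: "\<forall>z\<in>ball 0 1. (\<forall>(j, \<alpha>)\<in>?I. g z $ e (j, \<alpha>) = lam j * tensor_power_component \<alpha> z) \<and>
           (\<forall>l. l \<notin> e ` ?I \<longrightarrow> g z $ l = 0)"
    using g unfolding is_weighted_orthogonal_sum_def by blast
  have comp: "g z $ e (j, \<alpha>) = lam j * tensor_power_component \<alpha> z"
    if "norm z < 1" "(j, \<alpha>) \<in> ?I" for z j \<alpha> using e that by fastforce
  have zero: "g z $ l = 0" if "norm z < 1" "l \<notin> e ` ?I" for z l using e that by simp
  have "hip (g z) (g w) = (\<Sum>l\<in>e ` ?I. g z $ l * cnj (g w $ l))"
    unfolding hip_def by (rule sum.mono_neutral_right) (auto simp: zero[OF z])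
  also have "\<dots> = (\<Sum>p\<in>?I. g z $ e p * cnj (g w $ e p))"
    by (rule sum.reindex[OF inj, unfolded o_def])
  also have "\<dots> = (\<Sum>(j, \<alpha>)\<in>?I. of_real ((cmod (lam j))\<^sup>2) *
      (tensor_power_component \<alpha> z * cnj (tensor_power_component \<alpha> w)))"
    unfolding complex_norm_square by (rule sum.cong) (auto simp: comp z w mult_ac)
  also have "?I = Sigma {1..k} (\<lambda>j. {\<alpha>. (\<Sum>i\<in>UNIV. \<alpha> i) = m j})"
    by (auto simp: orthogonal_sum_index_def)
  also have "(\<Sum>(j, \<alpha>)\<in>\<dots>. of_real ((cmod (lam j))\<^sup>2) *
      (tensor_power_component \<alpha> z * cnj (tensor_power_component \<alpha> w))) =
      (\<Sum>j=1..k. of_real ((cmod (lam j))\<^sup>2) * hip z w ^ m j)"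
    by (simp add: sum.Sigma[symmetric] finite_exponents sum_distrib_left[symmetric] tensor_power_kernel)
  finally show ?thesis .
qed

section \<open>Proper maps of balls\<close>

lemma ball_aut_homeomorphic_map:
  assumes "\<phi> \<in> ball_aut"
  shows "homeomorphic_map (top_of_set (ball 0 1)) (top_of_set (ball 0 1)) \<phi>"
proof -
  let ?i = "inv\<^bsub>ball_aut_group\<^esub> \<phi>"
  have "homeomorphic_maps (top_of_set (ball 0 1)) (top_of_set (ball 0 1)) \<phi> ?i"
    unfolding homeomorphic_maps_def
    using ball_aut_continuous[OF assms] ball_aut_continuous[OF ball_aut_inverse(1)[OF assms]]
      ball_autD(3)[OF assms] ball_aut_inverse[OF assms]
    by (auto simp: continuous_map_in_subtopology simp del: mem_ball mem_ball_0)
  then show ?thesis by (rule homeomorphic_maps_imp_map)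
qed

lemma proper_map_cong:
  assumes f: "proper_map X Y f" and eq: "\<And>x. x \<in> topspace X \<Longrightarrow> f x = g x"
  shows "proper_map X Y g"
proof -
  have "{x \<in> topspace X. g x = y} = {x \<in> topspace X. f x = y}" for y using eq by auto
  then show ?thesis
    using f closed_map_eq[of X Y f g] eq unfolding proper_map_def by simp
qed

lemma proper_holomorphic_ball_map_aut:
  assumes f: "proper_holomorphic_ball_map f" and \<phi>: "\<phi> \<in> ball_aut" and \<tau>: "\<tau> \<in> ball_aut"
    and g: "\<And>z. z \<in> ball 0 1 \<Longrightarrow> g z = \<tau> (f (\<phi> z))"
  shows "proper_holomorphic_ball_map g"
proof -
  have fB: "f ` ball 0 1 \<subseteq> ball 0 1" and fh: "holomorphic_map_on f (ball 0 1)"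
    and fp: "proper_map (top_of_set (ball 0 1)) (top_of_set (ball 0 1)) f"
    using f by (auto simp: proper_holomorphic_ball_map_def)
  have \<phi>B: "\<phi> ` ball 0 1 \<subseteq> ball 0 1" using ball_autD(3)[OF \<phi>] by blast
  have f\<phi>B: "(\<lambda>z. f (\<phi> z)) ` ball 0 1 \<subseteq> ball 0 1" using fB \<phi>B by blast
  have "holomorphic_map_on (\<lambda>z. f (\<phi> z)) (ball 0 1)"
    by (rule holomorphic_map_on_ball_compose[OF ball_autD(2)[OF \<phi>] fh \<phi>B])
  then have "holomorphic_map_on (\<lambda>z. \<tau> (f (\<phi> z))) (ball 0 1)"
    by (rule holomorphic_map_on_ball_compose[OF _ ball_autD(2)[OF \<tau>] f\<phi>B])
  then have "holomorphic_map_on g (ball 0 1)"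
    by (rule holomorphic_map_on_ball_cong) (simp only: g)
  moreover have "g ` ball 0 1 \<subseteq> ball 0 1"
    using f\<phi>B ball_autD(3)[OF \<tau>] by (auto simp: g image_subset_iff simp del: mem_ball mem_ball_0)
  moreover have "proper_map (top_of_set (ball 0 1)) (top_of_set (ball 0 1)) g"
  proof (rule proper_map_cong)
    show "proper_map (top_of_set (ball 0 1)) (top_of_set (ball 0 1)) (\<tau> \<circ> (f \<circ> \<phi>))"
      by (rule proper_map_compose[OF proper_map_compose[OF
          homeomorphic_imp_proper_map[OF ball_aut_homeomorphic_map[OF \<phi>]] fp]
          homeomorphic_imp_proper_map[OF ball_aut_homeomorphic_map[OF \<tau>]]])
  qed (simp add: g)
  ultimately show ?thesis by (simp add: proper_holomorphic_ball_map_def)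
qed

text \<open>
  Let \<open>p\<close> be the polynomial with \<open>(norm (h z))\<^sup>2 = p ((norm
  z)\<^sup>2)\<close>. As \<open>h\<close> maps into the ball, \<open>p 1 \<le> 1\<close>. If
  \<open>p 1 < 1\<close>, then \<open>h\<close> maps the whole ball into a compact subset of the
  ball, whose preimage is not compact.
\<close>

lemma proper_kernel_weights_sum_1:
  fixes h :: "complex ^ 'n \<Rightarrow> complex ^ 'm"
  assumes h: "proper_holomorphic_ball_map h" and M: "finite M" "\<And>m. m \<in> M \<Longrightarrow> c m > (0::real)"
    and kernel: "\<And>z. norm z < 1 \<Longrightarrow> hip (h z) (h z) = (\<Sum>m\<in>M. of_real (c m) * hip z z ^ m)"
  shows "(\<Sum>m\<in>M. c m) = 1"
proof -
  \<comment> \<open>An arbitrary unit vector.\<close>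
  define e :: "complex ^ 'n" where "e = axis undefined 1"
  have e: "norm e = 1" by (simp add: e_def)
  define p where "p = (\<lambda>x::real. \<Sum>m\<in>M. c m * x ^ m)"
  have hB: "norm (h z) < 1" if "norm z < 1" for z
    using h that by (auto simp: proper_holomorphic_ball_map_def image_subset_iff)
  have norm_h: "(norm (h z))\<^sup>2 = p ((norm z)\<^sup>2)" if "norm z < 1" for z
  proof -
    have "complex_of_real ((norm (h z))\<^sup>2) = of_real (p ((norm z)\<^sup>2))"
      using kernel[OF that] by (simp add: hip_self p_def)
    then show ?thesis by (simp only: of_real_eq_iff)
  qed
  have "p 1 \<le> 1"
  proof (rule tendsto_upperbound)
    show "(p \<longlongrightarrow> p 1) (at_left 1)"
      unfolding p_def by (intro tendsto_intros)
    have "p x \<le> 1" if "0 < x" "x < 1" for x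
    proof -
      define z where "z = of_real (sqrt x) *s e"
      have nz: "norm z = sqrt x" using that e unfolding z_def norm_csmult norm_of_real by simp
      then have z: "norm z < 1" using that by (simp add: real_sqrt_lt_1_iff)
      have "p x = (norm (h z))\<^sup>2" using norm_h[OF z] nz that by simp
      also have "\<dots> \<le> 1" using hB[OF z] by (simp add: power_le_one)
      finally show ?thesis .
    qed
    then show "\<forall>\<^sub>F x in at_left 1. p x \<le> 1"
      using eventually_at_left_real[of 0 1] by (auto elim!: eventually_mono)
  qed simp
  moreover have "p 1 \<ge> 1"
  proof (rule ccontr)
    assume less: "\<not> p 1 \<ge> 1"
    let ?B = "ball (0 :: complex ^ 'n) 1"
    have p1: "p 1 \<ge> 0" unfolding p_def by (simp add: sum_nonneg less_imp_le M(2))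
    define C where "C = cball (0 :: complex ^ 'm) (sqrt (p 1))"
    have hC: "h z \<in> C" if "norm z < 1" for z
    proof -
      have "p ((norm z)\<^sup>2) \<le> p 1"
        unfolding p_def using M that by (intro sum_mono mult_left_mono power_mono) (auto simp: power_le_one less_imp_le)
      then have "(norm (h z))\<^sup>2 \<le> p 1" using norm_h[OF that] by simp
      then show ?thesis by (simp add: C_def real_le_rsqrt)
    qed
    have "C \<subseteq> ball 0 1" using less p1 by (auto simp: C_def) (meson less_le_trans not_le order_le_less_trans real_sqrt_lt_1_iff)
    then have "compactin (top_of_set (ball 0 1)) C" by (simp add: compactin_subtopology C_def)
    then have "compactin (top_of_set ?B) {z \<in> topspace (top_of_set ?B). h z \<in> C}"
      using h by (intro compactin_proper_map_preimage) (auto simp: proper_holomorphic_ball_map_def)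
    moreover have "{z \<in> topspace (top_of_set ?B). h z \<in> C} = ?B" using hC by auto
    ultimately have "closed ?B" by (simp add: compactin_subtopology compact_imp_closed)
    then have "cball (0 :: complex ^ 'n) 1 = ?B" by (metis closure_ball closure_closed zero_less_one)
    moreover have "e \<in> cball 0 1" "e \<notin> ?B" using e by simp_all
    ultimately show False by blast
  qed
  ultimately show ?thesis by (simp add: p_def)
qed

text \<open>
  Enumerate the degrees in increasing order and take the square roots of the coefficients as
  weights. The components fit into the target because they are as many as the monomials of the
  kernel of \<open>h\<close>.
\<close>

lemma weighted_orthogonal_sum_exists:
  fixes h :: "complex ^ 'n \<Rightarrow> complex ^ 'm"
  assumes M: "finite M" "\<And>m. m \<in> M \<Longrightarrow> c m > (0::real)"
    and kernel: "\<And>z w. norm z < 1 \<Longrightarrow> norm w < 1 \<Longrightarrow>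
      hip (h z) (h w) = (\<Sum>m\<in>M. of_real (c m) * hip z w ^ m)"
  shows "\<exists>m lam (g :: complex ^ 'n \<Rightarrow> complex ^ 'm). strict_mono_on {1..card M} m \<and>
    (\<Sum>j=1..card M. (cmod (lam j))\<^sup>2) = (\<Sum>m\<in>M. c m) \<and>
    is_weighted_orthogonal_sum (card M) m lam g \<and>
    (\<forall>z w. norm z < 1 \<longrightarrow> norm w < 1 \<longrightarrow> hip (g z) (g w) = hip (h z) (h w))"
proof -
  obtain d where d: "bij_betw d {..<card M} M" and mono: "strict_mono_on {..<card M} d"
    using ex_bij_betw_strict_mono_card[OF M(1)] by blast
  \<comment> \<open>The enumeration \<open>d\<close> starts at \<open>0\<close>, the summands are numbered from \<open>1\<close>.\<close>
  define m where "m = (\<lambda>j. d (j - 1))"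
  have m_mono: "strict_mono_on {1..card M} m"
  proof (rule strict_mono_onI)
    fix r s assume "r \<in> {1..card M}" "s \<in> {1..card M}" "r < s"
    then show "m r < m s" unfolding m_def by (intro strict_mono_onD[OF mono]) auto
  qed
  have "bij_betw (\<lambda>j. j - 1) {1..card M} {..<card M}"
    by (rule bij_betwI[where g = Suc]) auto
  from bij_betw_trans[OF this d] have m: "bij_betw m {1..card M} M" by (simp add: m_def o_def)
  have cm: "c (m j) > 0" if "j \<in> {1..card M}" for j using M(2) bij_betwE[OF m] that by blast
  define lam where "lam = (\<lambda>j. complex_of_real (sqrt (c (m j))))"
  have lam: "(cmod (lam j))\<^sup>2 = c (m j)" if "j \<in> {1..card M}" for j
    using cm[OF that] by (simp add: lam_def)
  have sum_M: "(\<Sum>j=1..card M. F (m j)) = (\<Sum>i\<in>M. F i)" for F :: "nat \<Rightarrow> 'x::comm_monoid_add"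
    by (rule sum.reindex_bij_betw[OF m])
  let ?I = "orthogonal_sum_index (card M) m :: (nat \<times> ('n \<Rightarrow> nat)) set"
  have "card ?I \<le> CARD('m)"
  proof -
    define J where "J = {\<alpha> :: 'n \<Rightarrow> nat. (\<Sum>i\<in>UNIV. \<alpha> i) \<in> M}"
    have J: "J = (\<Union>d\<in>M. {\<alpha>. (\<Sum>i\<in>UNIV. \<alpha> i) = d})" by (auto simp: J_def)
    have finJ: "finite J" unfolding J using M(1) finite_exponents by blast
    define a where "a = (\<lambda>\<alpha> :: 'n \<Rightarrow> nat. complex_of_real (sqrt (fact (\<Sum>i\<in>UNIV. \<alpha> i) / (\<Prod>i\<in>UNIV. fact (\<alpha> i)))))"
    define C where "C = (\<lambda>\<alpha>. complex_of_real (sqrt (c (\<Sum>i\<in>UNIV. \<alpha> i))) * a \<alpha>)"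
    have "card J \<le> CARD('m)"
    proof (rule card_monomials_le_dimension[where h = h and C = C, OF finJ])
      show "C \<alpha> \<noteq> 0" if "\<alpha> \<in> J" for \<alpha>
        using M(2)[of "\<Sum>i\<in>UNIV. \<alpha> i"] that by (simp add: J_def C_def a_def)
      fix z w :: "complex ^ 'n" assume z: "norm z < 1" and w: "norm w < 1"
      have "hip (h z) (h w) = (\<Sum>i\<in>M. \<Sum>\<alpha> | (\<Sum>i\<in>UNIV. \<alpha> i) = i.
          of_real (c i) * (tensor_power_component \<alpha> z * cnj (tensor_power_component \<alpha> w)))"
        by (simp add: kernel[OF z w] sum_distrib_left[symmetric] tensor_power_kernel)
      also have "\<dots> = (\<Sum>i\<in>M. \<Sum>\<alpha> | (\<Sum>i\<in>UNIV. \<alpha> i) = i.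
          (C \<alpha> * monomial \<alpha> z) * cnj (C \<alpha> * monomial \<alpha> w))"
      proof (intro sum.cong refl)
        fix i and \<alpha> :: "'n \<Rightarrow> nat" assume i: "i \<in> M" and \<alpha>: "\<alpha> \<in> {\<alpha>. (\<Sum>i\<in>UNIV. \<alpha> i) = i}"
        have "complex_of_real (sqrt (c i)) * of_real (sqrt (c i)) = of_real (c i)"
          unfolding of_real_mult[symmetric] using M(2)[OF i] by simp
        moreover have "C \<alpha> = of_real (sqrt (c i)) * a \<alpha>" using \<alpha> by (simp add: C_def)
        moreover have "tensor_power_component \<alpha> v = a \<alpha> * monomial \<alpha> v" for v
          by (simp add: tensor_power_component_def a_def)
        ultimately show "of_real (c i) * (tensor_power_component \<alpha> z * cnj (tensor_power_component \<alpha> w)) =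
            (C \<alpha> * monomial \<alpha> z) * cnj (C \<alpha> * monomial \<alpha> w)"
          by (simp add: mult_ac)
      qed
      also have "\<dots> = (\<Sum>\<alpha>\<in>J. (C \<alpha> * monomial \<alpha> z) * cnj (C \<alpha> * monomial \<alpha> w))"
        unfolding J by (rule sum.UNION_disjoint[symmetric]) (use M(1) finite_exponents in auto)
      finally show "hip (h z) (h w) = (\<Sum>\<alpha>\<in>J. (C \<alpha> * monomial \<alpha> z) * cnj (C \<alpha> * monomial \<alpha> w))" .
    qed
    moreover have "inj_on snd ?I"
    proof (rule inj_onI)
      fix p q assume "p \<in> ?I" "q \<in> ?I" "snd p = snd q"
      then have "fst p \<in> {1..card M}" "fst q \<in> {1..card M}" "m (fst p) = m (fst q)"
        by (auto simp: orthogonal_sum_index_def)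
      then have "fst p = fst q" using inj_onD[OF bij_betw_imp_inj_on[OF m]] by blast
      then show "p = q" using \<open>snd p = snd q\<close> by (rule prod_eqI)
    qed
    moreover have "snd ` ?I \<subseteq> J"
      using bij_betwE[OF m] by (auto simp: J_def orthogonal_sum_index_def)
    ultimately show ?thesis
      using card_mono[OF finJ, of "snd ` ?I"] card_image[of snd ?I] by linarith
  qed
  moreover have finI: "finite ?I"
  proof -
    have "?I = Sigma {1..card M} (\<lambda>j. {\<alpha>. (\<Sum>i\<in>UNIV. \<alpha> i) = m j})"
      by (auto simp: orthogonal_sum_index_def)
    then show ?thesis using finite_exponents by auto
  qed
  ultimately obtain e :: "nat \<times> ('n \<Rightarrow> nat) \<Rightarrow> 'm" where e: "inj_on e ?I"
    using inj_on_iff_card_le[of ?I "UNIV :: 'm set"] by auto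
  define g :: "complex ^ 'n \<Rightarrow> complex ^ 'm" where
    "g = (\<lambda>z. \<chi> l. if l \<in> e ` ?I then lam (fst (inv_into ?I e l)) * tensor_power_component (snd (inv_into ?I e l)) z else 0)"
  have g: "is_weighted_orthogonal_sum (card M) m lam g"
    unfolding is_weighted_orthogonal_sum_def
    by (rule exI[of _ e]) (auto simp: e g_def dest: inj_onD[OF e])
  have "hip (g z) (g w) = hip (h z) (h w)" if "norm z < 1" "norm w < 1" for z w
    unfolding weighted_orthogonal_sum_kernel[OF g that] kernel[OF that]
    by (subst sum_M[symmetric]) (simp add: lam flip: of_real_power)
  moreover have "(\<Sum>j=1..card M. (cmod (lam j))\<^sup>2) = (\<Sum>m\<in>M. c m)"
    by (subst sum_M[symmetric]) (simp add: lam)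
  ultimately show ?thesis using m_mono g by blast
qed

section \<open>Maps whose invariant group contains a maximal compact group\<close>

text \<open>
  The kernel of \<open>g\<close> depends on \<open>hip z w\<close> only, so \<open>g\<close>
  composed with a unitary matrix is \<open>g\<close> followed by a unitary matrix.
\<close>

lemma invariant_group_of_weighted_orthogonal_sum:
  fixes f g :: "complex ^ 'n \<Rightarrow> complex ^ 'm"
  assumes g: "is_weighted_orthogonal_sum k m lam g" and sph: "spherically_equivalent f g"
  shows "\<exists>\<phi>\<in>ball_aut. conjugate_of_unitary_auts \<phi> \<subseteq> hermitian_invariant_group f"
proof -
  obtain \<phi> \<eta> where \<phi>: "\<phi> \<in> ball_aut" and \<eta>: "\<eta> \<in> ball_aut"
    and f: "\<And>z. z \<in> ball 0 1 \<Longrightarrow> f z = \<eta> (g (\<phi> z))" and gp: "proper_holomorphic_ball_map g"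
    using sph unfolding spherically_equivalent_def by blast
  have gB: "g z \<in> ball 0 1" if "z \<in> ball 0 1" for z
    using gp that unfolding proper_holomorphic_ball_map_def by blast
  let ?i = "inv\<^bsub>ball_aut_group\<^esub> \<phi>"
  have inv_inv: "inv\<^bsub>ball_aut_group\<^esub> ?i = \<phi>"
    using group.inv_inv[OF group_ball_aut_group] \<phi> by simp
  have "conjugate_of_unitary_auts ?i \<subseteq> hermitian_invariant_group f"
  proof
    fix \<gamma> assume "\<gamma> \<in> conjugate_of_unitary_auts ?i"
    then obtain U where U: "unitary_matrix U"
      and \<gamma>: "\<gamma> = ?i \<otimes>\<^bsub>ball_aut_group\<^esub> restrict (\<lambda>z. U *v z) (ball 0 1) \<otimes>\<^bsub>ball_aut_group\<^esub> \<phi>"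
      unfolding conjugate_of_unitary_auts_def unitary_auts_def inv_inv by blast
    note u = unitary_ball_aut[OF U] and i = ball_aut_inverse(1)[OF \<phi>]
    have UB: "U *v z \<in> ball 0 1" if "z \<in> ball 0 1" for z using that by (simp add: norm_unitary U)
    have \<gamma>_aut: "\<gamma> \<in> ball_aut" unfolding \<gamma> by (intro ball_aut_mult(1) u i \<phi>)
    have \<gamma>_app: "\<gamma> z = ?i (U *v \<phi> z)" if "z \<in> ball 0 1" for z
      using that unfolding \<gamma>
      by (simp add: ball_aut_mult u i \<phi> ball_autD(3) del: mem_ball mem_ball_0)
    have "\<exists>V. unitary_matrix V \<and> (\<forall>w\<in>ball 0 1. g (U *v w) = V *v g w)"
    proof (rule unitary_extension)
      fix x y :: "complex ^ 'n" assume "x \<in> ball 0 1" "y \<in> ball 0 1"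
      then show "hip (g (U *v x)) (g (U *v y)) = hip (g x) (g y)"
        by (simp add: weighted_orthogonal_sum_kernel[OF g] norm_unitary U hip_unitary)
    qed
    then obtain V where V: "unitary_matrix V" "\<And>w. w \<in> ball 0 1 \<Longrightarrow> g (U *v w) = V *v g w" by blast
    note v = unitary_ball_aut[OF V(1)] and \<eta>i = ball_aut_inverse(1)[OF \<eta>]
    define \<psi> where "\<psi> = \<eta> \<otimes>\<^bsub>ball_aut_group\<^esub> restrict (\<lambda>z. V *v z) (ball 0 1) \<otimes>\<^bsub>ball_aut_group\<^esub>
      inv\<^bsub>ball_aut_group\<^esub> \<eta>"
    have \<psi>: "\<psi> \<in> ball_aut" unfolding \<psi>_def by (intro ball_aut_mult(1) v \<eta> \<eta>i)
    have "f (\<gamma> z) = \<psi> (f z)" if z: "z \<in> ball 0 1" for z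
    proof -
      have pz: "\<phi> z \<in> ball 0 1" by (rule ball_autD(3)[OF \<phi> z])
      have "f (\<gamma> z) = \<eta> (g (U *v \<phi> z))"
        using f[OF ball_autD(3)[OF \<gamma>_aut z]] unfolding \<gamma>_app[OF z]
        by (simp only: ball_aut_inverse(4)[OF \<phi> UB[OF pz]])
      also have "\<dots> = \<eta> (V *v g (\<phi> z))" by (simp only: V(2)[OF pz])
      also have "\<dots> = \<psi> (\<eta> (g (\<phi> z)))"
        unfolding \<psi>_def using gB[OF pz]
        by (simp add: ball_aut_mult v \<eta> \<eta>i ball_aut_inverse[OF \<eta>] ball_autD(3)[OF \<eta>] del: mem_ball mem_ball_0)
      finally show ?thesis by (simp only: f[OF z])
    qed
    then show "\<gamma> \<in> hermitian_invariant_group f"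
      using \<gamma>_aut \<psi> unfolding hermitian_invariant_group_def by blast
  qed
  then show ?thesis using ball_aut_inverse(1)[OF \<phi>] by blast
qed

text \<open>
  After composition with \<open>\<tau>\<close>, the automorphism of the target that compensates a
  unitary matrix fixes the image \<open>0\<close> of the origin. Hence it is unitary itself.
\<close>

lemma unitarily_invariant_kernel_after_normalisation:
  fixes f :: "complex ^ 'n \<Rightarrow> complex ^ 'm"
  assumes f: "proper_holomorphic_ball_map f" and \<phi>: "\<phi> \<in> ball_aut" and \<tau>: "\<tau> \<in> ball_aut"
    and sub: "conjugate_of_unitary_auts \<phi> \<subseteq> hermitian_invariant_group f"
    and zero: "\<tau> (f (\<phi> 0)) = 0"
  shows "unitarily_invariant_kernel (\<lambda>z. \<tau> (f (\<phi> z)))"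
  unfolding unitarily_invariant_kernel_def
proof (intro allI impI)
  fix U :: "complex ^ 'n ^ 'n" and z w :: "complex ^ 'n"
  assume U: "unitary_matrix U" and z: "norm z < 1" and w: "norm w < 1"
  let ?i = "inv\<^bsub>ball_aut_group\<^esub> \<phi>"
  let ?\<gamma> = "\<phi> \<otimes>\<^bsub>ball_aut_group\<^esub> restrict (\<lambda>z. U *v z) (ball 0 1) \<otimes>\<^bsub>ball_aut_group\<^esub> ?i"
  note u = unitary_ball_aut[OF U] and i = ball_aut_inverse(1)[OF \<phi>]
  have fB: "f z \<in> ball 0 1" if "z \<in> ball 0 1" for z
    using f that unfolding proper_holomorphic_ball_map_def by blast
  have "?\<gamma> \<in> hermitian_invariant_group f"
    using sub U unfolding conjugate_of_unitary_auts_def unitary_auts_def by blast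
  then obtain \<psi> where \<psi>: "\<psi> \<in> ball_aut" "\<forall>z\<in>ball 0 1. f (?\<gamma> z) = \<psi> (f z)"
    unfolding hermitian_invariant_group_def by blast
  have f_U: "f (\<phi> (U *v x)) = \<psi> (f (\<phi> x))" if x: "x \<in> ball 0 1" for x
  proof -
    have "?\<gamma> (\<phi> x) = \<phi> (U *v x)"
      using x by (simp add: ball_aut_mult u i \<phi> ball_autD(3) ball_aut_inverse[OF \<phi>] del: mem_ball mem_ball_0)
    then show ?thesis using \<psi>(2) ball_autD(3)[OF \<phi> x] by metis
  qed
  let ?\<theta> = "\<tau> \<otimes>\<^bsub>ball_aut_group\<^esub> \<psi> \<otimes>\<^bsub>ball_aut_group\<^esub> inv\<^bsub>ball_aut_group\<^esub> \<tau>"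
  have \<theta>: "?\<theta> \<in> ball_aut" by (intro ball_aut_mult(1) \<tau> \<psi>(1) ball_aut_inverse(1))
  have h_U: "\<tau> (f (\<phi> (U *v x))) = ?\<theta> (\<tau> (f (\<phi> x)))" if x: "x \<in> ball 0 1" for x
    unfolding f_U[OF x] using fB[OF ball_autD(3)[OF \<phi> x]]
    by (simp add: ball_aut_mult \<tau> \<psi>(1) ball_aut_inverse[OF \<tau>] ball_autD(3)[OF \<tau>] del: mem_ball mem_ball_0)
  have "?\<theta> 0 = 0" using h_U[of 0] zero by simp
  from ball_aut_fixing_0_unitary[OF \<theta> this] obtain V where V: "unitary_matrix V"
    "\<And>y. y \<in> ball 0 1 \<Longrightarrow> ?\<theta> y = V *v y" by blast
  have "\<tau> (f (\<phi> (U *v x))) = V *v \<tau> (f (\<phi> x))" if x: "x \<in> ball 0 1" for x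
    unfolding h_U[OF x] by (rule V(2)[OF ball_autD(3)[OF \<tau> fB[OF ball_autD(3)[OF \<phi> x]]]])
  then show "hip (\<tau> (f (\<phi> (U *v z)))) (\<tau> (f (\<phi> (U *v w)))) = hip (\<tau> (f (\<phi> z))) (\<tau> (f (\<phi> w)))"
    using z w by (simp add: hip_unitary[OF V(1)])
qed

text \<open>
  The involution \<open>\<tau>\<close> sends the image of the fixed point of the group to the
  origin. The normalised map and the weighted sum built from its kernel have the same Gram kernel,
  so they differ by a unitary matrix.
\<close>

proposition spherically_equivalent_to_weighted_orthogonal_sum:
  fixes f :: "complex ^ 'n \<Rightarrow> complex ^ 'm"
  assumes f: "proper_holomorphic_ball_map f" and \<phi>: "\<phi> \<in> ball_aut"
    and sub: "conjugate_of_unitary_auts \<phi> \<subseteq> hermitian_invariant_group f"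
  shows "\<exists>k m lam g. k \<ge> 1 \<and> strict_mono_on {1..k} m \<and> (\<Sum>j=1..k. (cmod (lam j))\<^sup>2) = 1 \<and>
     is_weighted_orthogonal_sum k m lam g \<and> spherically_equivalent f g"
proof -
  have fB: "f z \<in> ball 0 1" if "z \<in> ball 0 1" for z
    using f that unfolding proper_holomorphic_ball_map_def by blast
  define p where "p = f (\<phi> 0)"
  have p: "norm p < 1" using fB[OF ball_autD(3)[OF \<phi>, of 0]] by (simp add: p_def)
  define \<tau> where "\<tau> = restrict (ball_involution p) (ball 0 1)"
  have \<tau>: "\<tau> \<in> ball_aut" unfolding \<tau>_def by (rule ball_involution_ball_aut[OF p])
  have "\<tau> p = 0" using p by (simp add: \<tau>_def ball_involution_self)
  define h where "h = (\<lambda>z. \<tau> (f (\<phi> z)))"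
  have hp: "proper_holomorphic_ball_map h"
    by (rule proper_holomorphic_ball_map_aut[OF f \<phi> \<tau>]) (simp add: h_def)
  have inv: "unitarily_invariant_kernel h"
    unfolding h_def using \<open>\<tau> p = 0\<close>
    by (intro unitarily_invariant_kernel_after_normalisation[OF f \<phi> \<tau> sub]) (simp add: p_def)
  have hol: "holomorphic_map_on h (ball 0 1)" using hp by (simp add: proper_holomorphic_ball_map_def)
  obtain M and c :: "nat \<Rightarrow> real" where M: "finite M" "\<And>m. m \<in> M \<Longrightarrow> c m > 0"
    and kernel: "\<And>z w. norm z < 1 \<Longrightarrow> norm w < 1 \<Longrightarrow>
      hip (h z) (h w) = (\<Sum>m\<in>M. of_real (c m) * hip z w ^ m)"
    using unitarily_invariant_kernel_polynomial[OF inv hol] by blast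
  have c1: "(\<Sum>m\<in>M. c m) = 1"
    by (rule proper_kernel_weights_sum_1[OF hp M]) (simp_all add: kernel)
  have k: "card M \<ge> 1" using c1 M(1) by (cases "M = {}") (auto simp: Suc_le_eq card_gt_0_iff)
  obtain m lam and g :: "complex ^ 'n \<Rightarrow> complex ^ 'm" where m: "strict_mono_on {1..card M} m"
    and lam: "(\<Sum>j=1..card M. (cmod (lam j))\<^sup>2) = (\<Sum>m\<in>M. c m)"
    and g: "is_weighted_orthogonal_sum (card M) m lam g"
    and gram: "\<forall>z w. norm z < 1 \<longrightarrow> norm w < 1 \<longrightarrow> hip (g z) (g w) = hip (h z) (h w)"
    using weighted_orthogonal_sum_exists[OF M kernel] by blast
  have "\<exists>V. unitary_matrix V \<and> (\<forall>z\<in>ball 0 1. h z = V *v g z)"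
    by (rule unitary_extension) (simp add: gram)
  then obtain V where V: "unitary_matrix V" "\<And>z. z \<in> ball 0 1 \<Longrightarrow> h z = V *v g z" by blast
  let ?W = "conjugate_transpose V"
  note W = unitary_inverse[OF V(1)]
  note v = unitary_ball_aut[OF V(1)] and w = unitary_ball_aut[OF W(1)] and \<tau>i = ball_aut_inverse(1)[OF \<tau>]
  have gh: "g z = ?W *v h z" if "z \<in> ball 0 1" for z using V(2)[OF that] W(2) by simp
  have hB: "h z \<in> ball 0 1" if "z \<in> ball 0 1" for z
    unfolding h_def by (intro ball_autD(3)[OF \<tau>] fB ball_autD(3)[OF \<phi>] that)
  have gB: "g z \<in> ball 0 1" if "z \<in> ball 0 1" for z
    using hB[OF that] by (simp add: gh[OF that] norm_unitary[OF W(1)])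
  have "proper_holomorphic_ball_map g"
  proof (rule proper_holomorphic_ball_map_aut[OF f \<phi> ball_aut_mult(1)[OF w \<tau>]])
    fix z :: "complex ^ 'n" assume z: "z \<in> ball 0 1"
    have fz: "f (\<phi> z) \<in> ball 0 1" by (intro fB ball_autD(3)[OF \<phi>] z)
    show "g z = (restrict (\<lambda>z. ?W *v z) (ball 0 1) \<otimes>\<^bsub>ball_aut_group\<^esub> \<tau>) (f (\<phi> z))"
      using gh[OF z] hB[OF z] unfolding ball_aut_mult(2)[OF w \<tau> fz] h_def by (simp only: restrict_apply')
  qed
  moreover have "f z = (inv\<^bsub>ball_aut_group\<^esub> \<tau> \<otimes>\<^bsub>ball_aut_group\<^esub> restrict (\<lambda>z. V *v z) (ball 0 1))
      (g ((inv\<^bsub>ball_aut_group\<^esub> \<phi>) z))" if z: "z \<in> ball 0 1" for z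
  proof -
    let ?x = "(inv\<^bsub>ball_aut_group\<^esub> \<phi>) z"
    have x: "?x \<in> ball 0 1" by (rule ball_aut_inverse(2)[OF \<phi> z])
    have "(inv\<^bsub>ball_aut_group\<^esub> \<tau> \<otimes>\<^bsub>ball_aut_group\<^esub> restrict (\<lambda>z. V *v z) (ball 0 1)) (g ?x) =
        (inv\<^bsub>ball_aut_group\<^esub> \<tau>) (h ?x)"
      using gB[OF x] unfolding ball_aut_mult(2)[OF \<tau>i v gB[OF x]] V(2)[OF x] by (simp only: restrict_apply')
    also have "\<dots> = (inv\<^bsub>ball_aut_group\<^esub> \<tau>) (\<tau> (f z))"
      unfolding h_def by (simp only: ball_aut_inverse(4)[OF \<phi> z])
    also have "\<dots> = f z" by (rule ball_aut_inverse(3)[OF \<tau> fB[OF z]])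
    finally show ?thesis by simp
  qed
  ultimately have "spherically_equivalent f g"
    unfolding spherically_equivalent_def
    using f ball_aut_inverse(1)[OF \<phi>] ball_aut_mult(1)[OF \<tau>i v] by blast
  then show ?thesis using k m lam g c1 by metis
qed

theorem theorem5p2:
  fixes f :: "complex ^ 'n \<Rightarrow> complex ^ 'm"
  assumes "CARD('m) \<ge> CARD('n)" and "CARD('n) \<ge> 1"
    and "proper_holomorphic_ball_map f"
    and "rational_on_ball f"
  shows "(\<forall>K :: (complex ^ 'n \<Rightarrow> complex ^ 'n) set.
            maximal_compact_subgroup K \<longleftrightarrow> (\<exists>\<phi>\<in>ball_aut. K = conjugate_of_unitary_auts \<phi>)) \<and>
         ((\<exists>K. maximal_compact_subgroup K \<and> K \<subseteq> hermitian_invariant_group f) \<longleftrightarrow>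
          (\<exists>k m lam g. k \<ge> 1 \<and> strict_mono_on {1..k} m \<and> (\<Sum>j=1..k. (cmod (lam j))\<^sup>2) = 1 \<and>
             is_weighted_orthogonal_sum k m lam g \<and> spherically_equivalent f g))"
proof (intro conjI allI maximal_compact_subgroup_iff_conjugate iffI)
  assume "\<exists>K. maximal_compact_subgroup K \<and> K \<subseteq> hermitian_invariant_group f"
  then obtain \<phi> where "\<phi> \<in> ball_aut" "conjugate_of_unitary_auts \<phi> \<subseteq> hermitian_invariant_group f"
    unfolding maximal_compact_subgroup_iff_conjugate by blast
  then show "\<exists>k m lam g. k \<ge> 1 \<and> strict_mono_on {1..k} m \<and> (\<Sum>j=1..k. (cmod (lam j))\<^sup>2) = 1 \<and>
      is_weighted_orthogonal_sum k m lam g \<and> spherically_equivalent f g"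
    by (rule spherically_equivalent_to_weighted_orthogonal_sum[OF assms(3)])
next
  assume "\<exists>k m lam g. k \<ge> 1 \<and> strict_mono_on {1..k} m \<and> (\<Sum>j=1..k. (cmod (lam j))\<^sup>2) = 1 \<and>
      is_weighted_orthogonal_sum k m lam g \<and> spherically_equivalent f g"
  then obtain \<phi> where "\<phi> \<in> ball_aut" "conjugate_of_unitary_auts \<phi> \<subseteq> hermitian_invariant_group f"
    using invariant_group_of_weighted_orthogonal_sum by blast
  then show "\<exists>K. maximal_compact_subgroup K \<and> K \<subseteq> hermitian_invariant_group f"
    unfolding maximal_compact_subgroup_iff_conjugate by blast
qed

end
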